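(* There exist affine planar vector fields $X$ and $Y$ on $\mathbb{R}^2$ such that the following is true: for any integer $k>0$, there exist a smooth $b$-family ($b\in\mathbb{R}$ in a neighborhood of $0$) of non-monotonic transition functions $\varphi_{b,k}:\mathbb{R}\to\mathbb{R}$, each with precisely $3$ critical points in $(-1,1)$, and a continuous function $b_k:[0,\varepsilon_k]\to\mathbb{R}$, with $\varepsilon_k>0$ small enough and $b_k(0)=0$, such that, for each $\varepsilon\in(0,\varepsilon_k]$, the $\varphi_{b,k}$-linear regularization $$Z_\varepsilon(x,y)=\frac{1+\varphi_{b,k}\left(\frac{x}{\varepsilon}\right)}{2}X(x,y)+\frac{1-\varphi_{b,k}\left(\frac{x}{\varepsilon}\right)}{2}Y(x,y)\quad\text{with } b=b_k(\varepsilon)$$ has at least $k+1$ hyperbolic limit cycles.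
   Context: A transition function is a $C^\infty$-smooth function $\varphi:\mathbb{R}\to\mathbb{R}$ with $\varphi(t)=-1$ for $t\le -1$ and $\varphi(t)=1$ for $t\ge 1$. It is called monotonic if in addition $\varphi'(t)>0$ for all $t\in(-1,1)$, and non-monotonic otherwise. A critical point of $\varphi$ is a point $t$ with $\varphi'(t)=0$. A smooth $b$-family of transition functions is a family $\varphi_b$ of transition functions such that $(t,b)\mapsto\varphi_b(t)$ is $C^\infty$. For planar vector fields $X,Y$ and a transition function $\varphi$, the $\varphi$-linear regularization of the piecewise vector field equal to $X$ for $x>0$ and $Y$ for $x<0$ is the family, for $\varepsilon>0$, of smooth vector fields $Z_\varepsilon(x,y)=\frac{1+\varphi(x/\varepsilon)}{2}X(x,y)+\frac{1-\varphi(x/\varepsilon)}{2}Y(x,y)$ on $\mathbb{R}^2$. A limit cycle is an isolated periodic orbit; it is hyperbolic if the derivative of its Poincaré return map at the corresponding fixed point is different from $1$. *)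

theory Defs
  imports "HOL-Analysis.Analysis"
begin

text \<open>Being of class \<open>C\<^sup>k\<close> and \<open>C\<^sup>\<infinity>\<close>; both notions are meant for open sets \<open>S\<close>.\<close>

primrec Ck_on :: "nat \<Rightarrow> 'a::real_normed_vector set \<Rightarrow> ('a \<Rightarrow> 'b::real_normed_vector) \<Rightarrow> bool" where
  "Ck_on 0 S f \<longleftrightarrow> continuous_on S f"
| "Ck_on (Suc k) S f \<longleftrightarrow> (\<forall>x\<in>S. f differentiable (at x)) \<and>
     (\<forall>v. Ck_on k S (\<lambda>x. frechet_derivative f (at x) v))"

definition smooth_on :: "'a::real_normed_vector set \<Rightarrow> ('a \<Rightarrow> 'b::real_normed_vector) \<Rightarrow> bool" where
  "smooth_on S f \<longleftrightarrow> (\<forall>k. Ck_on k S f)"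

definition transition_function :: "(real \<Rightarrow> real) \<Rightarrow> bool" where
  "transition_function \<phi> \<longleftrightarrow>
     smooth_on UNIV \<phi> \<and> (\<forall>t\<le>-1. \<phi> t = -1) \<and> (\<forall>t\<ge>1. \<phi> t = 1)"

definition monotonic_transition_function :: "(real \<Rightarrow> real) \<Rightarrow> bool" where
  "monotonic_transition_function \<phi> \<longleftrightarrow>
     transition_function \<phi> \<and> (\<forall>t\<in>{-1<..<1}. deriv \<phi> t > 0)"

definition non_monotonic_transition_function :: "(real \<Rightarrow> real) \<Rightarrow> bool" where
  "non_monotonic_transition_function \<phi> \<longleftrightarrow>
     transition_function \<phi> \<and> \<not> monotonic_transition_function \<phi>"

definition critical_points :: "(real \<Rightarrow> real) \<Rightarrow> real set" where
  "critical_points \<phi> = {t. deriv \<phi> t = 0}"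

text \<open>A family with parameter \<open>b\<close> ranging over the open set \<open>B\<close>.\<close>

definition smooth_transition_family :: "real set \<Rightarrow> (real \<Rightarrow> real \<Rightarrow> real) \<Rightarrow> bool" where
  "smooth_transition_family B \<phi> \<longleftrightarrow>
     (\<forall>b\<in>B. transition_function (\<phi> b)) \<and> smooth_on (UNIV \<times> B) (\<lambda>(t, b). \<phi> b t)"

type_synonym planar_vf = "real \<times> real \<Rightarrow> real \<times> real"

definition affine_vf :: "planar_vf \<Rightarrow> bool" where
  "affine_vf X \<longleftrightarrow> (\<exists>L c. linear L \<and> (\<forall>p. X p = L p + c))"

definition linear_regularization ::
    "(real \<Rightarrow> real) \<Rightarrow> planar_vf \<Rightarrow> planar_vf \<Rightarrow> real \<Rightarrow> planar_vf" where
  "linear_regularization \<phi> X Y \<epsilon> = (\<lambda>(x, y).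
     ((1 + \<phi> (x / \<epsilon>)) / 2) *\<^sub>R X (x, y) + ((1 - \<phi> (x / \<epsilon>)) / 2) *\<^sub>R Y (x, y))"

definition integral_curve_on :: "planar_vf \<Rightarrow> real set \<Rightarrow> (real \<Rightarrow> real \<times> real) \<Rightarrow> bool" where
  "integral_curve_on Z I \<gamma> \<longleftrightarrow>
     (\<forall>t\<in>I. (\<gamma> has_vector_derivative Z (\<gamma> t)) (at t within I))"

text \<open>Equilibria do not count as periodic orbits.\<close>

definition periodic_orbit :: "planar_vf \<Rightarrow> (real \<times> real) set \<Rightarrow> bool" where
  "periodic_orbit Z C \<longleftrightarrow> (\<exists>\<gamma> T. integral_curve_on Z UNIV \<gamma> \<and> T > 0 \<and>
     (\<forall>t. \<gamma> (t + T) = \<gamma> t) \<and> (\<exists>t. \<gamma> t \<noteq> \<gamma> 0) \<and> C = range \<gamma>)"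

definition limit_cycle :: "planar_vf \<Rightarrow> (real \<times> real) set \<Rightarrow> bool" where
  "limit_cycle Z C \<longleftrightarrow> periodic_orbit Z C \<and>
     (\<exists>U. open U \<and> C \<subseteq> U \<and> (\<forall>C'. periodic_orbit Z C' \<and> C' \<subseteq> U \<longrightarrow> C' = C))"

text \<open>The open segment through \<open>p\<close> in direction \<open>v\<close>, parametrized by \<open>s \<mapsto> p + s v\<close>.\<close>

definition section_segment :: "real \<times> real \<Rightarrow> real \<times> real \<Rightarrow> real \<Rightarrow> (real \<times> real) set" where
  "section_segment p v \<delta> = (\<lambda>s. p + s *\<^sub>R v) ` {-\<delta><..<\<delta>}"

definition transversal_section :: "planar_vf \<Rightarrow> real \<times> real \<Rightarrow> real \<times> real \<Rightarrow> real \<Rightarrow> bool" where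
  "transversal_section Z p v \<delta> \<longleftrightarrow>
     \<delta> > 0 \<and> v \<noteq> 0 \<and> (\<forall>q\<in>section_segment p v \<delta>. Z q \<notin> span {v})"

definition first_return ::
    "planar_vf \<Rightarrow> (real \<times> real) set \<Rightarrow> real \<times> real \<Rightarrow> real \<times> real \<Rightarrow> bool" where
  "first_return Z \<Sigma> q q' \<longleftrightarrow> (\<exists>\<gamma> \<tau>. \<tau> > 0 \<and> integral_curve_on Z {0..\<tau>} \<gamma> \<and>
     \<gamma> 0 = q \<and> \<gamma> \<tau> = q' \<and> q' \<in> \<Sigma> \<and> (\<forall>t\<in>{0<..<\<tau>}. \<gamma> t \<notin> \<Sigma>))"

text \<open>\<open>P\<close> is the germ at 0 of the Poincare return map of the section, written in the
  coordinate \<open>s\<close> of the section.\<close>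

definition poincare_return_map ::
    "planar_vf \<Rightarrow> real \<times> real \<Rightarrow> real \<times> real \<Rightarrow> real \<Rightarrow> (real \<Rightarrow> real) \<Rightarrow> bool" where
  "poincare_return_map Z p v \<delta> P \<longleftrightarrow> transversal_section Z p v \<delta> \<and>
     (\<forall>\<^sub>F s in nhds 0. s \<in> {-\<delta><..<\<delta>} \<and>
        first_return Z (section_segment p v \<delta>) (p + s *\<^sub>R v) (p + P s *\<^sub>R v))"

text \<open>The derivative of the return map at the fixed point does not depend on the point of
  the orbit or on the section, so hyperbolicity is tested on one of them. The condition
  \<open>P 0 = 0\<close> says that the orbit meets the section only at \<open>p\<close>.\<close>

definition hyperbolic_limit_cycle :: "planar_vf \<Rightarrow> (real \<times> real) set \<Rightarrow> bool" where
  "hyperbolic_limit_cycle Z C \<longleftrightarrow> limit_cycle Z C \<and>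
     (\<exists>p\<in>C. \<exists>v \<delta> P m. poincare_return_map Z p v \<delta> P \<and> P 0 = 0 \<and>
        (P has_real_derivative m) (at 0) \<and> m \<noteq> 1)"

end

theory Submission
  imports Defs
begin

text \<open>
  Take the two linear foci \<open>X(x, y) = (x - y, x + y)\<close> and \<open>Y(x, y) = (-x - y, x - y)\<close>, the first
  repelling and the second attracting, both rotating with speed \<open>1\<close>. Their \<open>\<phi>\<close>-regularization is
  \<open>Z(p) = J p + \<phi>(x/\<epsilon>) p\<close> with \<open>J\<close> the rotation by a right angle, so that in polar coordinates
  \<open>x = \<epsilon> e\<^sup>\<rho> cos t\<close>, \<open>y = \<epsilon> e\<^sup>\<rho> sin t\<close> the angle is the time and the logarithmic radius solves the scalar
  equation \<open>\<rho>' = \<phi>(e\<^sup>\<rho> cos t)\<close>. Since \<open>X\<close> and \<open>Y\<close> are homogeneous, \<open>\<epsilon>\<close> has disappeared: all values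
  of \<open>\<epsilon>\<close> have the same phase portrait up to a dilation. It therefore suffices to find, for each
  \<open>k\<close>, a single transition function, and the family can be taken constant in \<open>b\<close>, with \<open>b\<^sub>k = 0\<close>.

  Closed orbits are the fixed points \<open>s\<close> of the return map \<open>s \<mapsto> \<rho>(2\<pi>)\<close>, where \<open>\<rho>(0) = s\<close>. Two
  solutions differ by a solution of a linear equation, which gives uniqueness, monotonicity of the
  return map, and its derivative \<open>exp (\<integral> x \<phi>'(x) dt)\<close> along the orbit \<open>x = e\<^sup>\<rho> cos t\<close>
  (\<open>return_log_derivative\<close>). Monotonicity excludes closed orbits that wind more than once. A fixed
  point at which the exponent \<open>\<integral> x \<phi>'(x) dt\<close> does not vanish thus is isolated and hyperbolic,
  and so is the corresponding orbit (\<open>hyperbolic_limit_cycle_curve\<close>).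

  Fixed points are found by averaging. On \<open>[-1/2, 1/2]\<close> let \<open>\<phi> = \<delta> h\<close> with a polynomial \<open>h\<close> and a
  small \<open>\<delta> > 0\<close>. Then \<open>\<rho>(2\<pi>) - s\<close> is \<open>\<delta>\<close> times the average \<open>\<integral> h(e\<^sup>s cos t) dt\<close> up to \<open>O(\<delta>\<^sup>2)\<close>, and
  the exponent is \<open>\<delta>\<close> times the derivative of this average, so simple zeros of the average give
  hyperbolic cycles for small \<open>\<delta>\<close> (\<open>return_log_zero_from_average\<close>). The average of \<open>x\<close> is zero and
  that of \<open>x\<^sup>2\<^sup>j\<close> is a nonzero multiple of \<open>e\<^sup>2\<^sup>j\<^sup>s\<close>. The even part of \<open>h\<close> can thus be chosen
  such that the average is any given polynomial in \<open>e\<^sup>2\<^sup>s\<close>, in particular one with \<open>k + 1\<close> simple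
  positive zeros, while a large linear term, invisible to the average, makes \<open>h\<close> strictly increasing.

  It remains to continue the small increasing function \<open>\<delta> h\<close> to a transition function. This is
  done with smooth steps: one step down to \<open>-1\<close> on the left, and on the right four consecutive steps
  up to \<open>1\<close>. The derivative is positive inside the steps and vanishes at the three points where
  one step on the right ends and the next begins. These are the critical points.
\<close>

section \<open>Differentiability classes on the real line\<close>

text \<open>In one variable the iterated directional derivatives of \<open>Ck_on\<close> reduce to one chain of ordinary
derivatives. This description is stable under the algebraic operations by a plain induction, and
\<open>Ck_real_imp_Ck_on\<close> translates it back.\<close>

primrec Ck_real :: "nat \<Rightarrow> (real \<Rightarrow> real) \<Rightarrow> bool" where
  "Ck_real 0 f \<longleftrightarrow> continuous_on UNIV f"
| "Ck_real (Suc k) f \<longleftrightarrow> (\<exists>f'. (\<forall>x. (f has_real_derivative f' x) (at x)) \<and> Ck_real k f')"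

lemma Ck_real_SucI:
  "(\<And>x. (f has_real_derivative f' x) (at x)) \<Longrightarrow> Ck_real k f' \<Longrightarrow> Ck_real (Suc k) f"
  by auto

lemma Ck_real_imp_continuous: "Ck_real k f \<Longrightarrow> continuous_on UNIV f"
  by (cases k) (auto intro!: continuous_at_imp_continuous_on intro: DERIV_isCont)

lemma Ck_real_Suc_imp: "Ck_real (Suc k) f \<Longrightarrow> Ck_real k f"
proof (induction k arbitrary: f)
  case 0
  then show ?case using Ck_real_imp_continuous[of "Suc 0" f] by (simp del: Ck_real.simps(2))
next
  case (Suc k)
  then obtain f' where "\<And>x. (f has_real_derivative f' x) (at x)" "Ck_real (Suc k) f'"
    by (auto simp del: Ck_real.simps(2) simp: Ck_real.simps(2)[of "Suc k" f])
  with Suc.IH[of f'] show ?case by auto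
qed

lemma Ck_real_const [simp]: "Ck_real k (\<lambda>x. c)"
proof (induction k arbitrary: c)
  case (Suc k)
  have "\<forall>x. ((\<lambda>x. c) has_real_derivative 0) (at x)" by simp
  with Suc[of 0] show ?case by (auto intro!: exI[of _ "\<lambda>_. 0"])
qed simp

lemma Ck_real_ident [simp]: "Ck_real k (\<lambda>x. x)"
proof (cases k)
  case (Suc n)
  have "\<forall>x. ((\<lambda>x. x) has_real_derivative 1) (at x)" by simp
  with Suc show ?thesis by (auto intro!: exI[of _ "\<lambda>_. 1"])
qed simp

lemma Ck_real_add: "Ck_real k f \<Longrightarrow> Ck_real k g \<Longrightarrow> Ck_real k (\<lambda>x. f x + g x)"
proof (induction k arbitrary: f g)
  case 0
  then show ?case by (auto intro: continuous_on_add)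
next
  case (Suc k)
  then obtain f' g' where "\<And>x. (f has_real_derivative f' x) (at x)" "Ck_real k f'"
    "\<And>x. (g has_real_derivative g' x) (at x)" "Ck_real k g'" by auto
  with Suc.IH[of f' g'] show ?case
    by (auto intro!: exI[of _ "\<lambda>x. f' x + g' x"] DERIV_add)
qed

lemma Ck_real_mult: "Ck_real k f \<Longrightarrow> Ck_real k g \<Longrightarrow> Ck_real k (\<lambda>x. f x * g x)"
proof (induction k arbitrary: f g)
  case 0
  then show ?case by (auto intro: continuous_on_mult)
next
  case (Suc k)
  then obtain f' g' where f: "\<And>x. (f has_real_derivative f' x) (at x)" "Ck_real k f'"
    and g: "\<And>x. (g has_real_derivative g' x) (at x)" "Ck_real k g'" by auto
  have "Ck_real k (\<lambda>x. f' x * g x + f x * g' x)"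
    by (intro Ck_real_add Suc.IH f g Suc.prems[THEN Ck_real_Suc_imp])
  moreover have "((\<lambda>x. f x * g x) has_real_derivative f' x * g x + f x * g' x) (at x)" for x
    using DERIV_mult[OF f(1) g(1)] by (simp add: algebra_simps)
  ultimately show ?case by (rule Ck_real_SucI[rotated])
qed

lemma Ck_real_minus: "Ck_real k f \<Longrightarrow> Ck_real k (\<lambda>x. - f x)"
  using Ck_real_mult[of k "\<lambda>_. -1" f] by simp

lemma Ck_real_diff: "Ck_real k f \<Longrightarrow> Ck_real k g \<Longrightarrow> Ck_real k (\<lambda>x. f x - g x)"
  using Ck_real_add[OF _ Ck_real_minus, of k f g] by simp

lemma Ck_real_power: "Ck_real k f \<Longrightarrow> Ck_real k (\<lambda>x. f x ^ n)"
  by (induction n) (auto intro: Ck_real_mult)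

lemma Ck_real_sum: "(\<And>i. i \<in> I \<Longrightarrow> Ck_real k (f i)) \<Longrightarrow> Ck_real k (\<lambda>x. \<Sum>i\<in>I. f i x)"
  by (induction I rule: infinite_finite_induct) (auto intro: Ck_real_add)

lemma Ck_real_inverse:
  "Ck_real k f \<Longrightarrow> (\<And>x. f x \<noteq> 0) \<Longrightarrow> Ck_real k (\<lambda>x. inverse (f x))"
proof (induction k arbitrary: f)
  case 0
  then show ?case by (auto intro: continuous_on_inverse)
next
  case (Suc k)
  then obtain f' where f: "\<And>x. (f has_real_derivative f' x) (at x)" "Ck_real k f'" by auto
  have inv: "Ck_real k (\<lambda>x. inverse (f x))"
    by (intro Suc.IH Suc.prems(1)[THEN Ck_real_Suc_imp] Suc.prems(2))
  have "Ck_real k (\<lambda>x. - (inverse (f x) * f' x * inverse (f x)))"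
    by (intro Ck_real_minus Ck_real_mult inv f)
  moreover have "((\<lambda>x. inverse (f x)) has_real_derivative - (inverse (f x) * f' x * inverse (f x))) (at x)" for x
    using DERIV_inverse'[OF f(1) Suc.prems(2)] by simp
  ultimately show ?case by (rule Ck_real_SucI[rotated])
qed

lemma Ck_real_affine: "Ck_real k f \<Longrightarrow> Ck_real k (\<lambda>x. f (a * x + b))"
proof (induction k arbitrary: f)
  case 0
  then have f: "continuous_on UNIV f" by simp
  have "continuous_on UNIV (\<lambda>x::real. a * x + b)" by (intro continuous_intros)
  then show ?case unfolding Ck_real.simps by (rule continuous_on_compose2[OF f]) simp
next
  case (Suc k)
  then obtain f' where f: "\<And>x. (f has_real_derivative f' x) (at x)" "Ck_real k f'" by auto
  have "Ck_real k (\<lambda>x. f' (a * x + b) * a)"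
    by (rule Ck_real_mult[OF Suc.IH[OF f(2)] Ck_real_const])
  moreover have "((\<lambda>x. f (a * x + b)) has_real_derivative f' (a * x + b) * a) (at x)" for x
    by (rule DERIV_chain2[OF f(1)]) (auto intro!: derivative_eq_intros)
  ultimately show ?case by (rule Ck_real_SucI[rotated])
qed

text \<open>The linear map \<open>L\<close> covers both uses, a function on the line and a function of \<open>(t, b)\<close> that
depends on \<open>t\<close> only. The factor \<open>c\<close> is what the chain rule produces in the induction.\<close>

lemma Ck_real_imp_Ck_on:
  fixes L :: "'a::real_normed_vector \<Rightarrow> real"
  assumes L: "bounded_linear L"
  shows "Ck_real k f \<Longrightarrow> Ck_on k S (\<lambda>x. c * f (L x))"
proof (induction k arbitrary: f c)
  case 0
  then have f: "continuous_on UNIV f" by simp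
  have "continuous_on S L" using L by (rule linear_continuous_on)
  then have "continuous_on S (\<lambda>x. f (L x))" by (rule continuous_on_compose2[OF f]) simp
  then show ?case unfolding Ck_on.simps by (intro continuous_intros)
next
  case (Suc k)
  then obtain f' where f: "\<And>x. (f has_real_derivative f' x) (at x)" "Ck_real k f'" by auto
  have D: "((\<lambda>x. c * f (L x)) has_derivative (\<lambda>v. c * (f' (L x) * L v))) (at x)" for x
  proof -
    have "(L has_derivative L) (at x)" by (rule bounded_linear_imp_has_derivative[OF L])
    moreover have "(f has_derivative (\<lambda>v. f' (L x) * v)) (at (L x))"
      using f(1)[of "L x"] by (simp add: has_field_derivative_def)
    ultimately have "((\<lambda>x. f (L x)) has_derivative (\<lambda>v. f' (L x) * L v)) (at x)"
      by (rule has_derivative_compose)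
    then show ?thesis by (rule has_derivative_mult_right)
  qed
  have "frechet_derivative (\<lambda>x. c * f (L x)) (at x) v = (c * L v) * f' (L x)" for x v
    using frechet_derivative_at[OF D, of x, symmetric] by (simp add: algebra_simps)
  moreover have "(\<lambda>x. c * f (L x)) differentiable (at x)" for x
    using D by (rule differentiableI)
  ultimately show ?case using Suc.IH[OF f(2)] by simp
qed

lemma smooth_on_of_Ck_real:
  fixes L :: "'a::real_normed_vector \<Rightarrow> real"
  assumes "\<And>k. Ck_real k f" "bounded_linear L"
  shows "smooth_on S (\<lambda>x. f (L x))"
  using Ck_real_imp_Ck_on[OF assms(2) assms(1), where c = 1] by (simp add: smooth_on_def)

section \<open>A smooth step\<close>

text \<open>The derivative of \<open>q(1/x) exp (-1/x)\<close> is of the same form with another polynomial. Admitting all \<open>q\<close>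
turns the smoothness of \<open>exp (-1/x)\<close> at \<open>0\<close> into an induction that needs only first derivatives.\<close>

definition flat :: "real poly \<Rightarrow> real \<Rightarrow> real" where
  "flat q x = (if x > 0 then poly q (1 / x) * exp (- (1 / x)) else 0)"

lemma poly_times_exp_minus_tendsto_0:
  fixes q :: "real poly"
  shows "((\<lambda>y. poly q y * exp (- y)) \<longlongrightarrow> 0) at_top"
proof -
  have "((\<lambda>y. \<Sum>i\<le>degree q. coeff q i * (y ^ i / exp y)) \<longlongrightarrow> (\<Sum>i\<le>degree q. coeff q i * 0)) at_top"
    by (intro tendsto_sum tendsto_mult tendsto_const tendsto_power_div_exp_0)
  then show ?thesis
    by (simp add: poly_altdef sum_distrib_right exp_minus divide_inverse mult.assoc)
qed

lemma flat_tendsto_0: "(flat q \<longlongrightarrow> 0) (at 0)"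
proof -
  have "((\<lambda>x. poly q (inverse x) * exp (- inverse x)) \<longlongrightarrow> 0) (at_right 0)"
    by (rule filterlim_compose[OF poly_times_exp_minus_tendsto_0 filterlim_inverse_at_top_right])
  then have "(flat q \<longlongrightarrow> 0) (at_right 0)"
    by (rule Lim_transform_eventually)
       (auto simp: eventually_at_filter flat_def divide_inverse)
  moreover have "(flat q \<longlongrightarrow> 0) (at_left 0)"
    by (rule Lim_transform_eventually[OF tendsto_const])
       (auto simp: eventually_at_filter flat_def)
  ultimately show ?thesis by (simp add: filterlim_split_at)
qed

lemma flat_has_derivative:
  "(flat q has_real_derivative flat ([:0, 0, 1:] * (q - pderiv q)) x) (at x)"
proof -
  consider "x > 0" | "x < 0" | "x = 0" by linarith
  then show ?thesis
  proof cases
    case 1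
    have inv: "((\<lambda>x. 1 / x) has_real_derivative - (1 / x)\<^sup>2) (at x)"
      using 1 DERIV_inverse[of x UNIV] by (simp add: inverse_eq_divide power2_eq_square)
    have "((\<lambda>x. poly q (1 / x)) has_real_derivative poly (pderiv q) (1 / x) * - (1 / x)\<^sup>2) (at x)"
      by (rule DERIV_chain2[OF poly_DERIV inv])
    moreover have "((\<lambda>x. exp (- (1 / x))) has_real_derivative exp (- (1 / x)) * (1 / x)\<^sup>2) (at x)"
      using DERIV_chain2[OF DERIV_exp DERIV_minus[OF inv]] by simp
    ultimately have "((\<lambda>x. poly q (1 / x) * exp (- (1 / x))) has_real_derivative
        poly ([:0, 0, 1:] * (q - pderiv q)) (1 / x) * exp (- (1 / x))) (at x)"
      by (rule DERIV_cong[OF DERIV_mult]) (simp add: algebra_simps power2_eq_square)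
    moreover have "\<forall>\<^sub>F y in nhds x. flat q y = poly q (1 / y) * exp (- (1 / y))"
      using eventually_nhds_in_open[OF open_greaterThan, of x 0] 1
      by (auto simp: flat_def elim: eventually_mono)
    ultimately show ?thesis using 1 by (subst DERIV_cong_ev[OF refl _ refl]) (auto simp: flat_def)
  next
    case 2
    have "\<forall>\<^sub>F y in nhds x. flat q y = 0"
      using eventually_nhds_in_open[OF open_lessThan, of x 0] 2
      by (auto simp: flat_def elim: eventually_mono)
    then show ?thesis using 2 by (subst DERIV_cong_ev[OF refl _ refl]) (auto simp: flat_def)
  next
    case 3
    \<comment> \<open>dividing by \<open>y\<close> multiplies \<open>q\<close> by the variable, so the difference quotient is again flat\<close>
    have "(\<lambda>y. (flat q y - flat q 0) / (y - 0)) = flat (pCons 0 q)"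
      by (auto simp: flat_def)
    then show ?thesis using 3 flat_tendsto_0[of "pCons 0 q"]
      unfolding has_field_derivative_iff by (simp add: flat_def)
  qed
qed

lemma Ck_real_flat: "Ck_real k (flat q)"
proof (induction k arbitrary: q)
  case 0
  show ?case
    by (auto intro!: continuous_at_imp_continuous_on DERIV_isCont[OF flat_has_derivative])
next
  case (Suc k)
  then show ?case using flat_has_derivative by auto
qed

definition smooth_step :: "real \<Rightarrow> real" where
  "smooth_step x = flat 1 x / (flat 1 x + flat 1 (1 - x))"

lemma flat_1_pos: "x > 0 \<Longrightarrow> flat 1 x > 0"
  by (simp add: flat_def)

lemma flat_1_nonneg: "flat 1 x \<ge> 0"
  by (simp add: flat_def)

lemma smooth_step_denominator_pos: "flat 1 x + flat 1 (1 - x) > 0"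
proof (cases "x > 0")
  case True
  then show ?thesis using flat_1_pos flat_1_nonneg by (simp add: add_pos_nonneg)
next
  case False
  then show ?thesis using flat_1_pos[of "1 - x"] flat_1_nonneg by (simp add: add_nonneg_pos)
qed

lemma Ck_real_smooth_step: "Ck_real k smooth_step"
proof -
  have "Ck_real k (\<lambda>x. flat 1 (1 - x))"
    using Ck_real_affine[OF Ck_real_flat[of k 1], of "-1" 1] by simp
  then show ?thesis unfolding smooth_step_def[abs_def] divide_inverse
    by (intro Ck_real_mult Ck_real_inverse Ck_real_add Ck_real_flat
        less_imp_neq[OF smooth_step_denominator_pos, symmetric])
qed

lemma smooth_step_eq_0: "x \<le> 0 \<Longrightarrow> smooth_step x = 0"
  by (simp add: smooth_step_def flat_def)

lemma smooth_step_eq_1: "x \<ge> 1 \<Longrightarrow> smooth_step x = 1"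
  by (simp add: smooth_step_def flat_def)

lemma smooth_step_le_1: "smooth_step x \<le> 1"
  using smooth_step_denominator_pos[of x] flat_1_nonneg[of "1 - x"]
  by (simp add: smooth_step_def)

text \<open>The quotient rule, in a form that shows the sign: the polynomial \<open>[:0, 0, 1:]\<close> belongs to the
derivative of \<open>exp (-1/x)\<close>.\<close>

definition smooth_step' :: "real \<Rightarrow> real" where
  "smooth_step' x = (flat [:0, 0, 1:] x * flat 1 (1 - x) + flat 1 x * flat [:0, 0, 1:] (1 - x))
     / (flat 1 x + flat 1 (1 - x))\<^sup>2"

lemma smooth_step_has_derivative:
  "(smooth_step has_real_derivative smooth_step' x) (at x)"
proof -
  have 1: "(flat 1 has_real_derivative flat [:0, 0, 1:] x) (at x)" for x
    using flat_has_derivative[of 1 x] by (simp add: one_pCons)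
  have "((\<lambda>x. 1 - x) has_real_derivative -1) (at x)"
    by (auto intro!: derivative_eq_intros)
  from DERIV_chain2[OF 1 this]
  have 2: "((\<lambda>x. flat 1 (1 - x)) has_real_derivative - flat [:0, 0, 1:] (1 - x)) (at x)"
    by simp
  have "flat [:0, 0, 1:] x * (flat 1 x + flat 1 (1 - x))
      - flat 1 x * (flat [:0, 0, 1:] x + - flat [:0, 0, 1:] (1 - x))
    = flat [:0, 0, 1:] x * flat 1 (1 - x) + flat 1 x * flat [:0, 0, 1:] (1 - x)"
    by algebra
  then show ?thesis
    using DERIV_divide[OF 1 DERIV_add[OF 1 2]] smooth_step_denominator_pos[of x]
    by (simp add: smooth_step_def[abs_def] smooth_step'_def power2_eq_square)
qed

lemma smooth_step'_eq_0_left: "x \<le> 0 \<Longrightarrow> smooth_step' x = 0"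
  by (simp add: smooth_step'_def flat_def)

lemma smooth_step'_eq_0_right: "x \<ge> 1 \<Longrightarrow> smooth_step' x = 0"
  by (simp add: smooth_step'_def flat_def)

lemma smooth_step'_pos:
  assumes "0 < x" "x < 1" shows "smooth_step' x > 0"
proof -
  have "flat q y > 0" if "y > 0" "poly q (1 / y) > 0" for q y
    using that by (simp add: flat_def)
  then show ?thesis unfolding smooth_step'_def using assms smooth_step_denominator_pos[of x]
    by (intro divide_pos_pos add_pos_pos mult_pos_pos zero_less_power) auto
qed

lemma smooth_step'_ge_0: "smooth_step' x \<ge> 0"
  using smooth_step'_pos[of x] smooth_step'_eq_0_left[of x] smooth_step'_eq_0_right[of x] by linarith

section \<open>Primitives and scalar differential equations on the whole line\<close>

text \<open>The primitive that vanishes at \<open>0\<close>. The integral over an empty interval is zero, so one of the two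
terms vanishes for \<open>t \<noteq> 0\<close>, and the function is a primitive on both sides of \<open>0\<close>.\<close>

definition primitive :: "(real \<Rightarrow> real) \<Rightarrow> real \<Rightarrow> real" where
  "primitive h t = integral {0..t} h - integral {t..0} h"

lemma primitive_0 [simp]: "primitive h 0 = 0"
  by (simp add: primitive_def)

lemma primitive_eq_integral: "t \<ge> 0 \<Longrightarrow> primitive h t = integral {0..t} h"
  by (cases "t = 0") (simp_all add: primitive_def)

lemma primitive_has_derivative:
  assumes h: "continuous_on UNIV h"
  shows "(primitive h has_real_derivative h t) (at t)"
proof -
  define a b where "a = min 0 t - 1" and "b = max 0 t + 1"
  have hc: "continuous_on {u..v} h" for u v
    using h by (rule continuous_on_subset) simp
  have int: "h integrable_on {u..v}" for u v
    using hc by (rule integrable_continuous_real)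
  have eq: "primitive h u = integral {a..u} h - integral {a..0} h" if "a < u" for u
  proof (cases "u \<ge> 0")
    case True
    have "integral {a..0} h + integral {0..u} h = integral {a..u} h"
      by (rule Henstock_Kurzweil_Integration.integral_combine) (use True int in \<open>auto simp: a_def\<close>)
    then show ?thesis using True by (simp add: primitive_eq_integral)
  next
    case False
    have "integral {a..u} h + integral {u..0} h = integral {a..0} h"
      by (rule Henstock_Kurzweil_Integration.integral_combine) (use that False int in auto)
    then show ?thesis using False by (simp add: primitive_def)
  qed
  have "((\<lambda>u. integral {a..u} h) has_real_derivative h t) (at t within {a..b})"
    by (rule integral_has_real_derivative[OF hc]) (auto simp: a_def b_def)
  moreover have "t \<in> interior {a..b}" by (auto simp: a_def b_def)
  ultimately have "((\<lambda>u. integral {a..u} h) has_real_derivative h t) (at t)"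
    by (simp only: at_within_interior)
  then have "((\<lambda>u. integral {a..u} h - integral {a..0} h) has_real_derivative h t - 0) (at t)"
    by (rule DERIV_diff[OF _ DERIV_const])
  moreover have "\<forall>\<^sub>F u in nhds t. primitive h u = integral {a..u} h - integral {a..0} h"
  proof (rule eventually_mono)
    show "\<forall>\<^sub>F u in nhds t. u \<in> {a<..}"
      by (rule eventually_nhds_in_open) (auto simp: a_def)
  qed (simp add: eq)
  ultimately show ?thesis by (subst DERIV_cong_ev[OF refl _ refl]) auto
qed

lemma continuous_on_primitive:
  assumes "continuous_on UNIV h" shows "continuous_on A (primitive h)"
proof (rule continuous_at_imp_continuous_on, rule ballI)
  show "isCont (primitive h) t" for t
    using primitive_has_derivative[OF assms] by (rule DERIV_isCont)
qed

lemma linear_ode_solution: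
  assumes e: "\<And>t. (e has_real_derivative a t * e t) (at t)" and a: "continuous_on UNIV a"
  shows "e t = e 0 * exp (primitive a t)"
proof -
  have E: "((\<lambda>t. exp (- primitive a t)) has_real_derivative exp (- primitive a t) * - a t) (at t)" for t
    by (rule DERIV_chain2[OF DERIV_exp DERIV_minus[OF primitive_has_derivative[OF a]]])
  have "((\<lambda>t. e t * exp (- primitive a t)) has_real_derivative 0) (at t)" for t
    by (rule DERIV_cong[OF DERIV_mult[OF e E]]) simp
  then have "e t * exp (- primitive a t) = e 0 * exp (- primitive a 0)"
    using DERIV_isconst_all[of "\<lambda>t. e t * exp (- primitive a t)" t 0] by blast
  then show ?thesis by (simp add: exp_minus field_simps)
qed

lemma growth_bound_nonneg_time:
  assumes F: "\<And>t. (F has_real_derivative h t) (at t)" "F 0 = 0"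
    and h: "\<And>t. t \<ge> 0 \<Longrightarrow> \<bar>h t\<bar> \<le> D * K * exp (K * t)" and t: "t \<ge> 0"
  shows "\<bar>F t\<bar> \<le> D * (exp (K * t) - 1)"
proof -
  have E: "((\<lambda>t. D * exp (K * t)) has_real_derivative D * K * exp (K * t)) (at t)" for t
    by (auto intro!: derivative_eq_intros)
  have 1: "D * exp (K * 0) - F 0 \<le> D * exp (K * t) - F t"
  proof (rule DERIV_nonneg_imp_nondecreasing[OF t], intro exI conjI)
    fix x :: real assume "0 \<le> x"
    show "((\<lambda>t. D * exp (K * t) - F t) has_real_derivative D * K * exp (K * x) - h x) (at x)"
      by (rule DERIV_diff[OF E F(1)])
    show "0 \<le> D * K * exp (K * x) - h x" using h[OF \<open>0 \<le> x\<close>] by linarith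
  qed
  have 2: "D * exp (K * 0) + F 0 \<le> D * exp (K * t) + F t"
  proof (rule DERIV_nonneg_imp_nondecreasing[OF t], intro exI conjI)
    fix x :: real assume "0 \<le> x"
    show "((\<lambda>t. D * exp (K * t) + F t) has_real_derivative D * K * exp (K * x) + h x) (at x)"
      by (rule DERIV_add[OF E F(1)])
    show "0 \<le> D * K * exp (K * x) + h x" using h[OF \<open>0 \<le> x\<close>] by linarith
  qed
  from 1 2 show ?thesis using F(2) by (simp add: algebra_simps abs_le_iff)
qed

text \<open>The exponential weight in \<open>global_solution_exists\<close> is made for this bound: integration of
\<open>exp (K |t|)\<close> gains the factor \<open>1 / K\<close>.\<close>

lemma growth_bound:
  assumes F: "\<And>t. (F has_real_derivative h t) (at t)" "F 0 = 0"
    and h: "\<And>t. \<bar>h t\<bar> \<le> D * K * exp (K * \<bar>t\<bar>)"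
  shows "\<bar>F t\<bar> \<le> D * (exp (K * \<bar>t\<bar>) - 1)"
proof (cases "t \<ge> 0")
  case True
  have "\<bar>h t\<bar> \<le> D * K * exp (K * t)" if "t \<ge> 0" for t using h[of t] that by simp
  from growth_bound_nonneg_time[OF F this True] show ?thesis using True by simp
next
  case False
  have F': "((\<lambda>t. F (- t)) has_real_derivative - h (- t)) (at t)" for t
    using DERIV_chain2[OF F(1) DERIV_minus[OF DERIV_ident], where x = t] by simp
  have "\<bar>- h (- t)\<bar> \<le> D * K * exp (K * t)" if "t \<ge> 0" for t using h[of "-t"] that by simp
  from growth_bound_nonneg_time[OF F' _ this, of "- t"] show ?thesis using False F(2) by simp
qed

text \<open>Picard iteration on the whole line at once. The unknown is \<open>u\<close> in \<open>\<rho>(t) = s + exp (K |t|) u(t)\<close>,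
a bounded continuous function. In terms of \<open>u\<close> the integral operator has Lipschitz constant
\<open>L / K\<close>, which is at most \<open>1/2\<close> for \<open>K\<close> large, so Banach's fixed point theorem applies without any
restriction on the length of the time interval.\<close>

lemma global_solution_exists:
  fixes g :: "real \<Rightarrow> real \<Rightarrow> real"
  assumes cont: "continuous_on UNIV (\<lambda>(t, x). g t x)"
    and bounded: "\<And>t x. \<bar>g t x\<bar> \<le> M"
    and lipschitz: "\<And>t x y. \<bar>g t x - g t y\<bar> \<le> L * \<bar>x - y\<bar>"
  shows "\<exists>\<rho>. \<rho> 0 = s \<and> (\<forall>t. (\<rho> has_real_derivative g t (\<rho> t)) (at t))"
proof -
  define K where "K = 2 * \<bar>L\<bar> + 1"
  have K: "K > 0" "\<bar>L\<bar> / K \<le> 1 / 2" by (auto simp: K_def field_simps)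
  have M: "M \<ge> 0" using bounded[of 0 0] by linarith
  define h where "h u \<tau> = g \<tau> (s + exp (K * \<bar>\<tau>\<bar>) * apply_bcontfun u \<tau>)"
    for u :: "real \<Rightarrow>\<^sub>C real" and \<tau>
  define N where "N u t = exp (- (K * \<bar>t\<bar>)) * primitive (h u) t" for u t
  have h: "continuous_on UNIV (h u)" for u
  proof -
    have c: "continuous_on UNIV (\<lambda>\<tau>. (\<tau>, s + exp (K * \<bar>\<tau>\<bar>) * apply_bcontfun u \<tau>))"
      by (intro continuous_intros) auto
    show ?thesis using continuous_on_compose2[OF cont c] by (simp add: h_def[abs_def])
  qed
  note P = primitive_has_derivative[OF h] primitive_0
  have N_bounded: "\<bar>N u t\<bar> \<le> M / K" for u t
  proof -
    have "\<bar>h u t\<bar> \<le> M / K * K * exp (K * \<bar>t\<bar>)" for t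
    proof -
      have "\<bar>h u t\<bar> \<le> M * 1" using bounded by (simp add: h_def)
      also have "\<dots> \<le> M * exp (K * \<bar>t\<bar>)" using M K by (intro mult_left_mono) auto
      finally show ?thesis using K by simp
    qed
    from growth_bound[OF P this]
    have "\<bar>primitive (h u) t\<bar> \<le> M / K * (exp (K * \<bar>t\<bar>) - 1)" .
    also have "\<dots> \<le> M / K * exp (K * \<bar>t\<bar>)" using M K by (intro mult_left_mono) auto
    finally show ?thesis by (simp add: N_def abs_mult exp_minus field_simps)
  qed
  have "continuous_on UNIV (N u)" for u
    unfolding N_def by (intro continuous_intros continuous_on_primitive h)
  then have N: "N u \<in> bcontfun" for u
    by (rule bcontfun_normI[where b = "M / K"]) (simp add: N_bounded)
  define T where "T u = Bcontfun (N u)" for u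
  have T: "apply_bcontfun (T u) t = N u t" for u t
    using N by (simp add: T_def Bcontfun_inverse)
  have "\<forall>u v. dist (T u) (T v) \<le> 1 / 2 * dist u v"
  proof (intro allI dist_bound)
    fix u v :: "real \<Rightarrow>\<^sub>C real" and t
    have "\<bar>h u t - h v t\<bar> \<le> \<bar>L\<bar> * dist u v / K * K * exp (K * \<bar>t\<bar>)" for t
    proof -
      have "\<bar>h u t - h v t\<bar> \<le> L * \<bar>exp (K * \<bar>t\<bar>) * (u t - v t)\<bar>"
        using lipschitz[of t "s + exp (K * \<bar>t\<bar>) * u t" "s + exp (K * \<bar>t\<bar>) * v t"]
        by (simp add: h_def right_diff_distrib)
      also have "\<dots> = L * (exp (K * \<bar>t\<bar>) * dist (u t) (v t))" by (simp add: abs_mult dist_real_def)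
      also have "\<dots> \<le> \<bar>L\<bar> * (exp (K * \<bar>t\<bar>) * dist u v)"
        by (intro mult_mono mult_left_mono dist_bounded) auto
      finally show ?thesis using K by (simp add: mult_ac)
    qed
    from growth_bound[where F = "\<lambda>t. primitive (h u) t - primitive (h v) t", OF DERIV_diff[OF P(1) P(1)] _ this]
    have "\<bar>primitive (h u) t - primitive (h v) t\<bar> \<le> \<bar>L\<bar> * dist u v / K * (exp (K * \<bar>t\<bar>) - 1)"
      by simp
    also have "\<dots> \<le> \<bar>L\<bar> * dist u v / K * exp (K * \<bar>t\<bar>)" using K by (intro mult_left_mono) auto
    finally have "exp (- (K * \<bar>t\<bar>)) * \<bar>primitive (h u) t - primitive (h v) t\<bar> \<le> \<bar>L\<bar> * dist u v / K"
      by (simp add: exp_minus field_simps)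
    moreover have "dist (T u t) (T v t) = exp (- (K * \<bar>t\<bar>)) * \<bar>primitive (h u) t - primitive (h v) t\<bar>"
      by (simp add: T N_def dist_real_def right_diff_distrib[symmetric] abs_mult)
    moreover have "\<bar>L\<bar> * dist u v / K \<le> 1 / 2 * dist u v"
      using mult_right_mono[OF K(2), of "dist u v"] by simp
    ultimately show "dist (T u t) (T v t) \<le> 1 / 2 * dist u v" by linarith
  qed
  then obtain u where u: "T u = u"
    using banach_fix_type[of "1/2" T] by auto
  define \<rho> where "\<rho> t = s + primitive (h u) t" for t
  have "exp (K * \<bar>t\<bar>) * apply_bcontfun u t = primitive (h u) t" for t
    using T[of u t] by (simp add: u N_def exp_minus)
  then have "h u t = g t (\<rho> t)" for t by (simp add: h_def \<rho>_def)
  then have "(\<rho> has_real_derivative g t (\<rho> t)) (at t)" for t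
    unfolding \<rho>_def[abs_def] using DERIV_add[OF DERIV_const[of s] P(1)[of u t]]
    by (simp add: \<rho>_def)
  then show ?thesis by (intro exI[of _ \<rho>]) (simp add: \<rho>_def)
qed

section \<open>Divided differences\<close>

text \<open>Writing \<open>f x - f y\<close> as a continuous coefficient times \<open>x - y\<close> turns the difference of two
solutions of a differential equation into a solution of a linear equation.\<close>

definition divided_difference :: "(real \<Rightarrow> real) \<Rightarrow> (real \<Rightarrow> real) \<Rightarrow> real \<Rightarrow> real \<Rightarrow> real" where
  "divided_difference f f' x y = (if x = y then f' x else (f x - f y) / (x - y))"

lemma divided_difference_times: "divided_difference f f' x y * (x - y) = f x - f y"
  by (simp add: divided_difference_def)

lemma divided_difference_mean_value:
  assumes f: "\<And>x. (f has_real_derivative f' x) (at x)"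
  obtains z where "min x y \<le> z" "z \<le> max x y" "divided_difference f f' x y = f' z"
proof -
  consider "x = y" | "x < y" | "y < x" by linarith
  then show ?thesis
  proof cases
    case 1
    then show ?thesis using that[of x] by (simp add: divided_difference_def)
  next
    case 2
    from MVT2[OF 2, of f f'] f obtain z where "x < z" "z < y" "f y - f x = (y - x) * f' z" by auto
    then show ?thesis using that[of z] 2 by (simp add: divided_difference_def field_simps)
  next
    case 3
    from MVT2[OF 3, of f f'] f obtain z where "y < z" "z < x" "f x - f y = (x - y) * f' z" by auto
    then show ?thesis using that[of z] 3 by (simp add: divided_difference_def field_simps)
  qed
qed

text \<open>Near the diagonal the mean value theorem replaces the quotient by a nearby value of \<open>f'\<close>.\<close>

lemma continuous_on_divided_difference:
  assumes f: "\<And>x. (f has_real_derivative f' x) (at x)" and f': "continuous_on UNIV f'"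
  shows "continuous_on UNIV (\<lambda>(x, y). divided_difference f f' x y)"
proof (rule continuous_at_imp_continuous_on, rule ballI)
  fix p :: "real \<times> real"
  obtain a b where p: "p = (a, b)" by (cases p)
  show "isCont (\<lambda>(x, y). divided_difference f f' x y) p"
  proof (cases "a = b")
    case False
    have fc: "isCont f x" for x using f by (rule DERIV_isCont)
    have "isCont (\<lambda>q. (f (fst q) - f (snd q)) / (fst q - snd q)) p"
      using False unfolding p
      by (intro continuous_intros isCont_o2[OF _ fc]) auto
    moreover have "open {q :: real \<times> real. fst q \<noteq> snd q}"
      by (intro open_Collect_neq continuous_intros)
    then have "\<forall>\<^sub>F q in nhds p. fst q \<noteq> snd q"
      using eventually_nhds_in_open[of "{q :: real \<times> real. fst q \<noteq> snd q}" p] False p by simp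
    then have "\<forall>\<^sub>F q in nhds p. (case q of (x, y) \<Rightarrow> divided_difference f f' x y)
        = (f (fst q) - f (snd q)) / (fst q - snd q)"
      by eventually_elim (auto simp: divided_difference_def split: prod.splits)
    ultimately show ?thesis by (subst isCont_cong)
  next
    case True
    show ?thesis unfolding continuous_at_eps_delta
    proof (intro allI impI)
      fix e :: real assume "e > 0"
      with f' obtain d where d: "d > 0" "\<And>z. dist z a < d \<Longrightarrow> dist (f' z) (f' a) < e"
        by (metis UNIV_I continuous_on_iff)
      show "\<exists>d>0. \<forall>q. dist q p < d \<longrightarrow>
          dist (case q of (x, y) \<Rightarrow> divided_difference f f' x y)
            (case p of (x, y) \<Rightarrow> divided_difference f f' x y) < e"
      proof (intro exI[of _ d] conjI d allI impI)
        fix q :: "real \<times> real" assume q: "dist q p < d"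
        obtain x y where xy: "q = (x, y)" by (cases q)
        have "dist x a < d" "dist y a < d"
          using q True dist_fst_le[of q p] dist_snd_le[of q p] unfolding p xy by auto
        moreover obtain z where z: "min x y \<le> z" "z \<le> max x y" "divided_difference f f' x y = f' z"
          using divided_difference_mean_value[of f f' x y, OF f] .
        ultimately have "dist z a < d" by (auto simp: dist_real_def abs_less_iff min_def max_def split: if_splits)
        then show "dist (case q of (x, y) \<Rightarrow> divided_difference f f' x y)
            (case p of (x, y) \<Rightarrow> divided_difference f f' x y) < e"
          using d(2) z(3) True by (simp add: p xy divided_difference_def)
      qed
    qed
  qed
qed

section \<open>The polar flow\<close>

text \<open>The last assumption makes \<open>\<rho> \<mapsto> \<phi> (e\<^sup>\<rho> cos t)\<close> globally Lipschitz, because its derivative is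
\<open>x \<phi>'(x)\<close> at \<open>x = e\<^sup>\<rho> cos t\<close>. For a transition function it holds since \<open>\<phi>'\<close> has compact support.\<close>

locale polar_profile =
  fixes \<phi> \<phi>' :: "real \<Rightarrow> real" and L :: real
  assumes \<phi>_derivative: "\<And>x. (\<phi> has_real_derivative \<phi>' x) (at x)"
    and \<phi>'_continuous: "continuous_on UNIV \<phi>'"
    and \<phi>_bounded: "\<And>x. \<bar>\<phi> x\<bar> \<le> 1"
    and \<phi>_log_lipschitz: "\<And>x. \<bar>x * \<phi>' x\<bar> \<le> L"
begin

text \<open>The difference quotient of \<open>\<rho> \<mapsto> \<phi> (e\<^sup>\<rho> cos t)\<close> between \<open>x\<close> and \<open>y\<close>, factored by the chain rule so
that joint continuity in all three variables can be read off.\<close>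

definition slope :: "real \<Rightarrow> real \<Rightarrow> real \<Rightarrow> real" where
  "slope t x y = cos t * divided_difference \<phi> \<phi>' (exp x * cos t) (exp y * cos t)
     * divided_difference exp exp x y"

lemma slope_times: "slope t x y * (x - y) = \<phi> (exp x * cos t) - \<phi> (exp y * cos t)"
proof -
  have "slope t x y * (x - y) = divided_difference \<phi> \<phi>' (exp x * cos t) (exp y * cos t)
      * (cos t * (divided_difference exp exp x y * (x - y)))"
    by (simp add: slope_def)
  also have "cos t * (divided_difference exp exp x y * (x - y)) = exp x * cos t - exp y * cos t"
    by (simp only: divided_difference_times left_diff_distrib mult.commute[of "cos t"])
  finally show ?thesis by (simp only: divided_difference_times)
qed

lemma slope_same: "slope t x x = exp x * cos t * \<phi>' (exp x * cos t)"
  by (simp add: slope_def divided_difference_def)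

lemma slope_bounded: "\<bar>slope t x y\<bar> \<le> L"
proof -
  define f where "f x = \<phi> (exp x * cos t)" for x
  define f' where "f' x = \<phi>' (exp x * cos t) * (exp x * cos t)" for x
  have f: "(f has_real_derivative f' x) (at x)" for x
    unfolding f_def[abs_def] f'_def
    by (rule DERIV_chain2[OF \<phi>_derivative]) (auto intro!: derivative_eq_intros)
  have "slope t x y = divided_difference f f' x y"
  proof (cases "x = y")
    case True
    then show ?thesis by (simp add: slope_same divided_difference_def f'_def)
  next
    case False
    then show ?thesis using slope_times[of t x y]
      by (simp add: divided_difference_def f_def eq_divide_eq)
  qed
  moreover obtain z where "divided_difference f f' x y = f' z"
    using divided_difference_mean_value[of f f' x y, OF f] by blast
  ultimately show ?thesis using \<phi>_log_lipschitz[of "exp z * cos t"]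
    by (simp add: f'_def mult.commute)
qed

lemma continuous_on_slope:
  fixes f g h :: "'a::t2_space \<Rightarrow> real"
  assumes "continuous_on A f" "continuous_on A g" "continuous_on A h"
  shows "continuous_on A (\<lambda>z. slope (f z) (g z) (h z))"
proof -
  have 1: "continuous_on A (\<lambda>z. (exp (g z) * cos (f z), exp (h z) * cos (f z)))"
    and 2: "continuous_on A (\<lambda>z. (g z, h z))"
    using assms by (auto intro!: continuous_intros)
  have "continuous_on A (\<lambda>z. divided_difference \<phi> \<phi>' (exp (g z) * cos (f z)) (exp (h z) * cos (f z)))"
    using continuous_on_compose2[OF continuous_on_divided_difference[OF \<phi>_derivative \<phi>'_continuous] 1]
    by simp
  moreover have "continuous_on A (\<lambda>z. divided_difference exp exp (g z) (h z))"
    using continuous_on_compose2[OF continuous_on_divided_difference[OF DERIV_exp continuous_on_exp[OF continuous_on_id]] 2]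
    by simp
  ultimately show ?thesis unfolding slope_def by (intro continuous_intros assms)
qed

lemma \<phi>_continuous: "continuous_on A \<phi>"
proof (rule continuous_at_imp_continuous_on, rule ballI)
  show "isCont \<phi> x" for x using \<phi>_derivative by (rule DERIV_isCont)
qed

definition polar_solution :: "(real \<Rightarrow> real) \<Rightarrow> bool" where
  "polar_solution \<rho> \<longleftrightarrow> (\<forall>t. (\<rho> has_real_derivative \<phi> (exp (\<rho> t) * cos t)) (at t))"

lemma polar_solution_exists: "\<exists>\<rho>. polar_solution \<rho> \<and> \<rho> 0 = s"
proof -
  have c: "continuous_on UNIV (\<lambda>(t, x). \<phi> (exp x * cos t))"
  proof -
    have "continuous_on UNIV (\<lambda>z :: real \<times> real. exp (snd z) * cos (fst z))"
      by (intro continuous_intros)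
    from continuous_on_compose2[OF \<phi>_continuous this, of UNIV] show ?thesis
      by (simp add: case_prod_beta)
  qed
  have "\<bar>\<phi> (exp x * cos t) - \<phi> (exp y * cos t)\<bar> \<le> L * \<bar>x - y\<bar>" for t x y
    using mult_right_mono[OF slope_bounded[of t x y], of "\<bar>x - y\<bar>"]
    by (simp add: slope_times[symmetric] abs_mult)
  from global_solution_exists[OF c \<phi>_bounded this, of s] show ?thesis
    unfolding polar_solution_def by blast
qed

definition flow :: "real \<Rightarrow> real \<Rightarrow> real" where
  "flow s = (SOME \<rho>. polar_solution \<rho> \<and> \<rho> 0 = s)"

lemma flow_solution: "polar_solution (flow s)" and flow_0 [simp]: "flow s 0 = s"
  using someI_ex[OF polar_solution_exists[of s]] by (simp_all add: flow_def)

lemma flow_derivative: "(flow s has_real_derivative \<phi> (exp (flow s t) * cos t)) (at t)"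
  using flow_solution by (simp add: polar_solution_def)

lemma polar_solution_continuous:
  assumes "polar_solution \<rho>" shows "continuous_on A \<rho>"
proof (rule continuous_at_imp_continuous_on, rule ballI)
  show "isCont \<rho> t" for t
    using assms[unfolded polar_solution_def, rule_format, of t] by (rule DERIV_isCont)
qed

lemma flow_continuous: "continuous_on A (flow s)"
  by (rule polar_solution_continuous[OF flow_solution])

text \<open>The difference of two solutions satisfies a linear equation. Everything about the dependence on the
initial value comes from this formula: uniqueness, monotonicity, continuity, and the derivative of
the return map.\<close>

lemma polar_solution_difference:
  assumes "polar_solution x" "polar_solution y"
  shows "x t - y t = (x 0 - y 0) * exp (primitive (\<lambda>t. slope t (x t) (y t)) t)"
proof (rule linear_ode_solution)
  show "((\<lambda>t. x t - y t) has_real_derivative slope t (x t) (y t) * (x t - y t)) (at t)" for t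
    using DERIV_diff[of x _ t UNIV y] assms unfolding slope_times polar_solution_def by blast
  show "continuous_on UNIV (\<lambda>t. slope t (x t) (y t))"
    by (intro continuous_on_slope polar_solution_continuous assms continuous_on_id)
qed

lemma flow_unique:
  assumes "polar_solution \<rho>" shows "\<rho> = flow (\<rho> 0)"
proof
  show "\<rho> t = flow (\<rho> 0) t" for t
    using polar_solution_difference[OF assms flow_solution[of "\<rho> 0"], of t] by simp
qed

lemma flow_shift: "flow s (t + 2 * pi) = flow (flow s (2 * pi)) t"
proof -
  have "((\<lambda>t. flow s (t + 2 * pi)) has_real_derivative \<phi> (exp (flow s (t + 2 * pi)) * cos (t + 2 * pi)) * 1) (at t)" for t
    by (rule DERIV_chain2[OF flow_derivative]) (auto intro!: derivative_eq_intros)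
  then have "polar_solution (\<lambda>t. flow s (t + 2 * pi))" by (simp add: polar_solution_def)
  from fun_cong[OF flow_unique[OF this], of t] show ?thesis by simp
qed

lemma flow_less_iff: "flow a t < flow b t \<longleftrightarrow> a < b"
proof -
  have "flow a t - flow b t < 0 \<longleftrightarrow> a - b < 0"
    using polar_solution_difference[OF flow_solution[of a] flow_solution[of b], of t]
    by (simp add: mult_less_0_iff)
  then show ?thesis by simp
qed

lemma flow_lipschitz_time: "\<bar>flow s t - flow s u\<bar> \<le> \<bar>t - u\<bar>"
proof -
  obtain z where "divided_difference (flow s) (\<lambda>t. \<phi> (exp (flow s t) * cos t)) t u = \<phi> (exp (flow s z) * cos z)"
    using divided_difference_mean_value[of "flow s" "\<lambda>t. \<phi> (exp (flow s t) * cos t)" t u, OF flow_derivative]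
    by blast
  then have "flow s t - flow s u = \<phi> (exp (flow s z) * cos z) * (t - u)"
    using divided_difference_times by metis
  then show ?thesis using mult_right_mono[OF \<phi>_bounded, of "\<bar>t - u\<bar>"]
    by (simp add: abs_mult)
qed

lemma flow_lipschitz_start: "\<bar>flow a t - flow b t\<bar> \<le> \<bar>a - b\<bar> * exp (L * \<bar>t\<bar>)"
proof -
  define h where "h t = slope t (flow a t) (flow b t)" for t
  have h: "continuous_on UNIV h"
    unfolding h_def by (intro continuous_on_slope flow_continuous continuous_on_id)
  have "\<bar>primitive h t\<bar> \<le> L * \<bar>t\<bar>"
  proof -
    obtain z where "divided_difference (primitive h) h t 0 = h z"
      using divided_difference_mean_value[of "primitive h" h t 0, OF primitive_has_derivative[OF h]]
      by blast
    then have "primitive h t = h z * t"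
      using divided_difference_times[of "primitive h" h t 0] by simp
    then show ?thesis using mult_right_mono[OF slope_bounded, of "\<bar>t\<bar>"]
      by (simp add: abs_mult h_def)
  qed
  then have "exp (primitive h t) \<le> exp (L * \<bar>t\<bar>)" by simp
  moreover have "\<bar>flow a t - flow b t\<bar> = \<bar>a - b\<bar> * exp (primitive h t)"
    using polar_solution_difference[OF flow_solution[of a] flow_solution[of b], of t]
    by (simp add: h_def[abs_def] abs_mult)
  ultimately show ?thesis by (simp add: mult_left_mono)
qed

lemma continuous_on_flow: "continuous_on UNIV (\<lambda>(s, t). flow s t)"
proof (rule continuous_at_imp_continuous_on, rule ballI)
  fix p :: "real \<times> real"
  obtain s0 t0 where p: "p = (s0, t0)" by (cases p)
  have "((\<lambda>q. flow (fst q) (snd q) - flow s0 t0) \<longlongrightarrow> 0) (at p)"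
  proof (rule Lim_null_comparison)
    have "\<bar>flow (fst q) (snd q) - flow s0 t0\<bar> \<le> \<bar>fst q - s0\<bar> * exp (L * \<bar>snd q\<bar>) + \<bar>snd q - t0\<bar>" for q
      using flow_lipschitz_start[of "fst q" "snd q" s0] flow_lipschitz_time[of s0 "snd q" t0] by linarith
    then show "\<forall>\<^sub>F q in at p. norm (flow (fst q) (snd q) - flow s0 t0)
        \<le> \<bar>fst q - s0\<bar> * exp (L * \<bar>snd q\<bar>) + \<bar>snd q - t0\<bar>"
      by (simp add: always_eventually)
    have "((\<lambda>q. \<bar>fst q - s0\<bar> * exp (L * \<bar>snd q\<bar>) + \<bar>snd q - t0\<bar>) \<longlongrightarrow>
        \<bar>fst p - s0\<bar> * exp (L * \<bar>snd p\<bar>) + \<bar>snd p - t0\<bar>) (at p)"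
      by (intro tendsto_intros)
    then show "((\<lambda>q. \<bar>fst q - s0\<bar> * exp (L * \<bar>snd q\<bar>) + \<bar>snd q - t0\<bar>) \<longlongrightarrow> 0) (at p)"
      by (simp add: p)
  qed
  then show "isCont (\<lambda>(s, t). flow s t) p"
    unfolding isCont_def case_prod_beta by (simp add: p LIM_zero_iff)
qed

text \<open>The Poincare return map of the positive \<open>x\<close>-axis in the logarithm of the radius.\<close>

definition return_log :: "real \<Rightarrow> real" where
  "return_log s = flow s (2 * pi)"

text \<open>The integral over one turn of the derivative of the equation in \<open>\<rho>\<close>, that is, the characteristic
exponent of a closed orbit.\<close>

definition exponent :: "real \<Rightarrow> real" where
  "exponent s = integral {0..2 * pi} (\<lambda>t. exp (flow s t) * cos t * \<phi>' (exp (flow s t) * cos t))"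

text \<open>By \<open>polar_solution_difference\<close> the difference quotient of the return map at \<open>s0\<close> is the exponential
of an integral that depends continuously on \<open>s\<close>. Its value at \<open>s0\<close> is the derivative.\<close>

lemma return_log_derivative: "(return_log has_real_derivative exp (exponent s0)) (at s0)"
proof -
  define a where "a s t = slope t (flow s t) (flow s0 t)" for s t
  have f1: "continuous_on UNIV (\<lambda>z. flow (fst z) (snd z))"
    using continuous_on_flow by (simp add: case_prod_beta)
  have f2: "continuous_on UNIV (\<lambda>z::real \<times> real. flow s0 (snd z))"
    by (rule continuous_on_compose2[OF flow_continuous, of UNIV]) (auto intro!: continuous_intros)
  have "continuous_on UNIV (\<lambda>z. slope (snd z) (flow (fst z) (snd z)) (flow s0 (snd z)))"
    by (rule continuous_on_slope[OF _ f1 f2]) (intro continuous_intros)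
  then have "continuous_on (UNIV \<times> cbox 0 (2 * pi)) (\<lambda>(s, t). a s t)"
    unfolding a_def case_prod_beta by (rule continuous_on_subset) simp
  from integral_continuous_on_param[OF this]
  have c: "continuous_on UNIV (\<lambda>s. exp (integral {0..2 * pi} (a s)))"
    by (simp add: continuous_on_exp)
  have "return_log s - return_log s0 = exp (integral {0..2 * pi} (a s)) * (s - s0)" for s
    using polar_solution_difference[OF flow_solution[of s] flow_solution[of s0], of "2 * pi"]
    by (simp add: return_log_def primitive_eq_integral a_def[abs_def] mult.commute)
  moreover have "isCont (\<lambda>s. exp (integral {0..2 * pi} (a s))) s0"
    using c by (simp add: continuous_on_eq_continuous_at)
  moreover have "integral {0..2 * pi} (a s0) = exponent s0"
    by (simp add: a_def[abs_def] slope_same exponent_def)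
  ultimately show ?thesis unfolding CARAT_DERIV by (metis (no_types, lifting))
qed

lemma flow_periods: "flow s (2 * pi * real n) = (return_log ^^ n) s"
proof (induction n arbitrary: s)
  case (Suc n)
  have "flow s (2 * pi * real (Suc n)) = flow (return_log s) (2 * pi * real n)"
    using flow_shift[of s "2 * pi * real n"] by (simp add: return_log_def algebra_simps)
  then show ?case using Suc by (simp add: funpow_swap1)
qed simp

lemma return_log_less_iff: "return_log a < return_log b \<longleftrightarrow> a < b"
  by (simp add: return_log_def flow_less_iff)

text \<open>An increasing map of the line has no periodic points besides its fixed points. Hence every periodic
orbit of the planar field closes after the first turn.\<close>

lemma fixed_point_of_iterate:
  assumes n: "n > 0" and fix_n: "(return_log ^^ n) s = s"
  shows "return_log s = s"
proof (rule ccontr)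
  assume "return_log s \<noteq> s"
  then consider "return_log s < s" | "s < return_log s" by linarith
  then show False
  proof cases
    case 1
    have "(return_log ^^ Suc m) s < s" for m
      by (induction m) (use 1 return_log_less_iff in \<open>auto intro: less_trans\<close>)
    then show False using n fix_n by (metis gr0_implies_Suc less_irrefl)
  next
    case 2
    have "s < (return_log ^^ Suc m) s" for m
      by (induction m) (use 2 return_log_less_iff in \<open>auto intro: less_trans\<close>)
    then show False using n fix_n by (metis gr0_implies_Suc less_irrefl)
  qed
qed

end

section \<open>Closed orbits of the regularization\<close>

text \<open>The two foci have the same rotation part and opposite radial parts, so that the regularization keeps
the rotation and multiplies the radial part by \<open>\<phi>\<close>.\<close>

definition repelling_focus :: planar_vf where
  "repelling_focus = (\<lambda>(x, y). (x - y, x + y))"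

definition attracting_focus :: planar_vf where
  "attracting_focus = (\<lambda>(x, y). (- x - y, x - y))"

lemma affine_repelling_focus: "affine_vf repelling_focus"
  unfolding affine_vf_def
  by (rule exI[of _ repelling_focus], rule exI[of _ 0], rule conjI, rule linearI)
    (auto simp: repelling_focus_def algebra_simps)

lemma affine_attracting_focus: "affine_vf attracting_focus"
  unfolding affine_vf_def
  by (rule exI[of _ attracting_focus], rule exI[of _ 0], rule conjI, rule linearI)
    (auto simp: attracting_focus_def algebra_simps)

abbreviation regularized_focus :: "(real \<Rightarrow> real) \<Rightarrow> real \<Rightarrow> planar_vf" where
  "regularized_focus \<phi> \<epsilon> \<equiv> linear_regularization \<phi> repelling_focus attracting_focus \<epsilon>"

lemma regularized_focus_eq:
  "regularized_focus \<phi> \<epsilon> p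
    = (\<phi> (fst p / \<epsilon>) * fst p - snd p, fst p + \<phi> (fst p / \<epsilon>) * snd p)"
  by (simp add: linear_regularization_def repelling_focus_def attracting_focus_def
      case_prod_beta field_simps)

lemma has_vector_derivative_pair_iff:
  "(\<gamma> has_vector_derivative (a, b)) (at t within S) \<longleftrightarrow>
    ((\<lambda>t. fst (\<gamma> t)) has_real_derivative a) (at t within S) \<and> ((\<lambda>t. snd (\<gamma> t)) has_real_derivative b) (at t within S)"
  unfolding has_real_derivative_iff_has_vector_derivative
proof
  assume "(\<gamma> has_vector_derivative (a, b)) (at t within S)"
  then show "((\<lambda>t. fst (\<gamma> t)) has_vector_derivative a) (at t within S) \<and> ((\<lambda>t. snd (\<gamma> t)) has_vector_derivative b) (at t within S)"
    using bounded_linear.has_vector_derivative[OF bounded_linear_fst]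
      bounded_linear.has_vector_derivative[OF bounded_linear_snd] by fastforce
next
  assume "((\<lambda>t. fst (\<gamma> t)) has_vector_derivative a) (at t within S) \<and> ((\<lambda>t. snd (\<gamma> t)) has_vector_derivative b) (at t within S)"
  then have "((\<lambda>t. (fst (\<gamma> t), snd (\<gamma> t))) has_vector_derivative (a, b)) (at t within S)"
    by (intro has_vector_derivative_Pair) auto
  then show "(\<gamma> has_vector_derivative (a, b)) (at t within S)" by simp
qed

context polar_profile
begin

definition curve :: "real \<Rightarrow> real \<Rightarrow> real \<Rightarrow> real \<times> real" where
  "curve \<epsilon> s t = (\<epsilon> * exp (flow s t) * cos t, \<epsilon> * exp (flow s t) * sin t)"

lemma integral_curve_curve:
  assumes "\<epsilon> > 0"
  shows "integral_curve_on (regularized_focus \<phi> \<epsilon>) I (curve \<epsilon> s)"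
  unfolding integral_curve_on_def
proof (rule ballI, rule has_vector_derivative_at_within)
  fix t
  let ?f = "\<phi> (exp (flow s t) * cos t)"
  have 1: "((\<lambda>t. \<epsilon> * exp (flow s t)) has_real_derivative \<epsilon> * (exp (flow s t) * ?f)) (at t)"
    by (rule DERIV_cmult[OF DERIV_chain2[OF DERIV_exp flow_derivative]])
  have "((\<lambda>t. fst (curve \<epsilon> s t)) has_real_derivative
      \<epsilon> * (exp (flow s t) * ?f) * cos t + - sin t * (\<epsilon> * exp (flow s t))) (at t)"
    using DERIV_mult[OF 1 DERIV_cos] by (simp add: curve_def)
  moreover have "((\<lambda>t. snd (curve \<epsilon> s t)) has_real_derivative
      \<epsilon> * (exp (flow s t) * ?f) * sin t + cos t * (\<epsilon> * exp (flow s t))) (at t)"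
    using DERIV_mult[OF 1 DERIV_sin] by (simp add: curve_def)
  moreover have "regularized_focus \<phi> \<epsilon> (curve \<epsilon> s t) =
      (\<epsilon> * (exp (flow s t) * ?f) * cos t + - sin t * (\<epsilon> * exp (flow s t)),
       \<epsilon> * (exp (flow s t) * ?f) * sin t + cos t * (\<epsilon> * exp (flow s t)))"
    using assms by (simp add: regularized_focus_eq curve_def algebra_simps)
  ultimately show "(curve \<epsilon> s has_vector_derivative regularized_focus \<phi> \<epsilon> (curve \<epsilon> s t)) (at t)"
    by (simp add: has_vector_derivative_pair_iff)
qed

text \<open>In the frame that rotates with speed \<open>1\<close> the field is a scalar multiple of the position, so both
rotating coordinates are multiplied by the same exponential. This gives the polar form of every
integral curve without lifting an angle.\<close>

lemma integral_curve_eq_curve: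
  assumes \<epsilon>: "\<epsilon> > 0" and \<gamma>: "integral_curve_on (regularized_focus \<phi> \<epsilon>) UNIV \<gamma>" and "\<gamma> 0 \<noteq> 0"
  obtains s a where "\<And>t. \<gamma> t = curve \<epsilon> s (t + a)"
proof -
  define x y f where "x t = fst (\<gamma> t)" and "y t = snd (\<gamma> t)" and "f t = \<phi> (x t / \<epsilon>)" for t
  have D: "(x has_real_derivative f t * x t - y t) (at t)"
    "(y has_real_derivative x t + f t * y t) (at t)" for t
    using \<gamma> unfolding integral_curve_on_def regularized_focus_eq has_vector_derivative_pair_iff
    by (simp_all add: x_def[abs_def] y_def[abs_def] f_def)
  have xc: "continuous_on UNIV x"
    using D(1) DERIV_isCont continuous_at_imp_continuous_on by blast
  have f: "continuous_on UNIV f" unfolding f_def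
    by (rule continuous_on_compose2[OF \<phi>_continuous[of UNIV]])
       (use \<epsilon> in \<open>auto intro!: continuous_intros xc\<close>)
  define A where "A = primitive f"
  have A: "(A has_real_derivative f t) (at t)" "A 0 = 0" for t
    unfolding A_def using primitive_has_derivative[OF f] by auto
  \<comment> \<open>\<open>u\<close> and \<open>v\<close> say how the coordinates in the rotating frame evolve\<close>
  have u: "x t * cos t + y t * sin t = x 0 * exp (A t)" for t
  proof -
    have "((\<lambda>t. x t * cos t + y t * sin t) has_real_derivative f t * (x t * cos t + y t * sin t)) (at t)" for t
      by (rule DERIV_cong[OF DERIV_add[OF DERIV_mult[OF D(1) DERIV_cos] DERIV_mult[OF D(2) DERIV_sin]]])
         (simp add: algebra_simps)
    from linear_ode_solution[OF this f, of t] show ?thesis by (simp add: A_def)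
  qed
  have v: "y t * cos t - x t * sin t = y 0 * exp (A t)" for t
  proof -
    have "((\<lambda>t. y t * cos t - x t * sin t) has_real_derivative f t * (y t * cos t - x t * sin t)) (at t)" for t
      by (rule DERIV_cong[OF DERIV_diff[OF DERIV_mult[OF D(2) DERIV_cos] DERIV_mult[OF D(1) DERIV_sin]]])
         (simp add: algebra_simps)
    from linear_ode_solution[OF this f, of t] show ?thesis by (simp add: A_def)
  qed
  obtain r a where ra: "Complex (x 0) (y 0) = rcis r a" "r = cmod (Complex (x 0) (y 0))"
    using rcis_cmod_Arg[of "Complex (x 0) (y 0)"] by metis
  have r: "r > 0" using \<open>\<gamma> 0 \<noteq> 0\<close> ra(2)
    by (auto simp: x_def y_def Complex_eq_0 prod_eq_iff)
  have xy0: "x 0 = r * cos a" "y 0 = r * sin a"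
    using ra(1) by (simp_all add: complex_eq_iff)
  have x: "x t = r * exp (A t) * cos (t + a)" for t
  proof -
    have "x t = x t * ((cos t)\<^sup>2 + (sin t)\<^sup>2)" by simp
    also have "\<dots> = (x t * cos t + y t * sin t) * cos t - (y t * cos t - x t * sin t) * sin t"
      by algebra
    also have "\<dots> = r * exp (A t) * cos (t + a)"
      unfolding u v xy0 by (simp add: cos_add algebra_simps)
    finally show ?thesis .
  qed
  have y: "y t = r * exp (A t) * sin (t + a)" for t
  proof -
    have "y t = y t * ((cos t)\<^sup>2 + (sin t)\<^sup>2)" by simp
    also have "\<dots> = (x t * cos t + y t * sin t) * sin t + (y t * cos t - x t * sin t) * cos t"
      by algebra
    also have "\<dots> = r * exp (A t) * sin (t + a)"
      unfolding u v xy0 by (simp add: sin_add algebra_simps)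
    finally show ?thesis .
  qed
  define \<rho> where "\<rho> t = ln (r / \<epsilon>) + A (t - a)" for t
  have \<rho>: "\<epsilon> * exp (\<rho> t) = r * exp (A (t - a))" for t
    using r \<epsilon> by (simp add: \<rho>_def exp_add)
  have "polar_solution \<rho>" unfolding polar_solution_def
  proof
    fix t
    have "(\<rho> has_real_derivative 0 + f (t - a) * 1) (at t)"
      unfolding \<rho>_def[abs_def]
      by (rule DERIV_add[OF DERIV_const DERIV_chain2[OF A(1)]]) (auto intro!: derivative_eq_intros)
    moreover have "x (t - a) / \<epsilon> = exp (\<rho> t) * cos t"
      using x[of "t - a"] \<rho>[of t] \<epsilon> by (simp add: field_simps)
    ultimately show "(\<rho> has_real_derivative \<phi> (exp (\<rho> t) * cos t)) (at t)"
      by (simp add: f_def)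
  qed
  then have fl: "flow (\<rho> 0) = \<rho>" using flow_unique by metis
  have "\<gamma> t = curve \<epsilon> (\<rho> 0) (t + a)" for t
    using x[of t] y[of t] \<rho>[of "t + a"] by (simp add: curve_def fl x_def y_def prod_eq_iff)
  then show ?thesis using that by blast
qed

text \<open>The angle is the time, so an orbit meets the positive \<open>x\<close>-axis exactly at multiples of \<open>2\<pi>\<close>.\<close>

lemma curve_on_positive_axis:
  assumes "\<epsilon> > 0" "curve \<epsilon> s t = (x, 0)" "x \<ge> 0"
  obtains n :: int where "t = of_int n * (2 * pi)"
proof -
  have "sin t = 0" using assms by (simp add: curve_def)
  moreover have "cos t \<ge> 0"
  proof -
    have "\<epsilon> * exp (flow s t) > 0" using assms(1) by simp
    moreover have "\<epsilon> * exp (flow s t) * cos t \<ge> 0" using assms by (simp add: curve_def)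
    ultimately show ?thesis by (simp only: zero_le_mult_iff) linarith
  qed
  ultimately have "cos t = 1"
    using sin_cos_squared_add[of t] by (simp add: power2_eq_1_iff)
  then show ?thesis using that by (metis cos_one_2pi_int mult.assoc mult.commute)
qed

lemma flow_periodic_nat:
  assumes "return_log s = s"
  shows "flow s (t + real n * (2 * pi)) = flow s t"
proof (induction n)
  case (Suc n)
  have "flow s (t + real (Suc n) * (2 * pi)) = flow s (t + real n * (2 * pi) + 2 * pi)"
    by (simp add: algebra_simps)
  then show ?case using flow_shift[of s "t + real n * (2 * pi)"] Suc assms by (simp add: return_log_def)
qed simp

lemma flow_periodic:
  assumes "return_log s = s"
  shows "flow s (of_int n * (2 * pi)) = s"
proof (cases "n \<ge> 0")
  case True
  then show ?thesis using flow_periodic_nat[OF assms, of 0 "nat n"] by simp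
next
  case False
  then show ?thesis using flow_periodic_nat[OF assms, of "of_int n * (2 * pi)" "nat (- n)"] by simp
qed

lemma closed_curve_on_positive_axis:
  assumes "\<epsilon> > 0" "return_log s = s" "(x, 0) \<in> range (curve \<epsilon> s)" "x \<ge> 0"
  shows "x = \<epsilon> * exp s"
proof -
  from assms(3) obtain t where t: "curve \<epsilon> s t = (x, 0)" by auto
  from curve_on_positive_axis[OF assms(1) t assms(4)] obtain n :: int where n: "t = of_int n * (2 * pi)" .
  moreover have "cos (of_int n * (2 * pi)) = 1"
    by (metis cos_one_2pi_int mult.assoc mult.commute)
  ultimately show ?thesis using t flow_periodic[OF assms(2), of n] by (simp add: curve_def)
qed

lemma curve_0: "curve \<epsilon> s 0 = (\<epsilon> * exp s, 0)"
  by (simp add: curve_def)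

lemma isolated_fixed_point:
  assumes "return_log s = s" "exponent s \<noteq> 0"
  shows "\<exists>\<eta>>0. \<forall>a. \<bar>a - s\<bar> < \<eta> \<longrightarrow> return_log a = a \<longrightarrow> a = s"
proof -
  have "((\<lambda>a. return_log a - a) has_real_derivative exp (exponent s) - 1) (at s)"
    by (rule DERIV_diff[OF return_log_derivative DERIV_ident])
  then have "((\<lambda>a. (return_log a - a) / (a - s)) \<longlongrightarrow> exp (exponent s) - 1) (at s)"
    using assms(1) by (simp add: has_field_derivative_iff)
  moreover have "exp (exponent s) - 1 \<noteq> 0" using assms(2) by simp
  ultimately have "\<forall>\<^sub>F a in at s. (return_log a - a) / (a - s) \<noteq> 0"
    by (rule tendsto_imp_eventually_ne)
  then obtain \<eta> where "\<eta> > 0"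
    and \<eta>: "\<forall>a. a \<noteq> s \<and> \<bar>a - s\<bar> < \<eta> \<longrightarrow> (return_log a - a) / (a - s) \<noteq> 0"
    unfolding eventually_at dist_real_def by auto
  have "a = s" if "\<bar>a - s\<bar> < \<eta>" "return_log a = a" for a
    using \<eta> that by (metis diff_self div_0)
  with \<open>\<eta> > 0\<close> show "\<exists>\<eta>>0. \<forall>a. \<bar>a - s\<bar> < \<eta> \<longrightarrow> return_log a = a \<longrightarrow> a = s"
    by blast
qed

lemma periodic_orbit_curve:
  assumes "\<epsilon> > 0" "return_log s = s"
  shows "periodic_orbit (regularized_focus \<phi> \<epsilon>) (range (curve \<epsilon> s))"
  unfolding periodic_orbit_def
proof (rule exI[of _ "curve \<epsilon> s"], rule exI[of _ "2 * pi"], intro conjI allI refl)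
  show "integral_curve_on (regularized_focus \<phi> \<epsilon>) UNIV (curve \<epsilon> s)"
    by (rule integral_curve_curve[OF assms(1)])
  show "curve \<epsilon> s (t + 2 * pi) = curve \<epsilon> s t" for t
    using flow_shift[of s t] assms(2) by (simp add: curve_def return_log_def)
  have "fst (curve \<epsilon> s pi) < 0" "fst (curve \<epsilon> s 0) > 0"
    using assms(1) by (simp_all add: curve_def)
  then show "\<exists>t. curve \<epsilon> s t \<noteq> curve \<epsilon> s 0" by (metis less_asym)
qed simp

text \<open>The neighbourhood \<open>U\<close> is the whole plane slit along the positive \<open>x\<close>-axis, origin included, except
for a small gap around the point where the cycle passes. A periodic orbit inside \<open>U\<close> has to cross
the axis through the gap, where the return map has no other fixed point.\<close>

lemma limit_cycle_curve:
  assumes \<epsilon>: "\<epsilon> > 0" and s: "return_log s = s" "exponent s \<noteq> 0"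
  shows "limit_cycle (regularized_focus \<phi> \<epsilon>) (range (curve \<epsilon> s))"
proof -
  obtain \<eta> where \<eta>: "\<eta> > 0" "\<And>a. \<bar>a - s\<bar> < \<eta> \<Longrightarrow> return_log a = a \<Longrightarrow> a = s"
    using isolated_fixed_point[OF s] by blast
  define U where "U = - (({0..\<epsilon> * exp (s - \<eta>)} \<union> {\<epsilon> * exp (s + \<eta>)..}) \<times> {0 :: real})"
  have "open U" unfolding U_def
    by (intro open_Compl closed_Times closed_Un closed_atLeastAtMost closed_atLeast closed_singleton)
  moreover have "range (curve \<epsilon> s) \<subseteq> U"
  proof
    fix p assume p: "p \<in> range (curve \<epsilon> s)"
    show "p \<in> U"
    proof (rule ccontr)
      assume "p \<notin> U"
      then obtain x where x: "p = (x, 0)" "0 \<le> x \<and> x \<le> \<epsilon> * exp (s - \<eta>) \<or> \<epsilon> * exp (s + \<eta>) \<le> x"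
        by (auto simp: U_def)
      have "0 \<le> \<epsilon> * exp (s + \<eta>)" using \<epsilon> by simp
      with x(2) have "x \<ge> 0" by linarith
      then have "x = \<epsilon> * exp s"
        using closed_curve_on_positive_axis[OF \<epsilon> s(1), of x] p x(1) by simp
      with x(2) \<epsilon> \<eta>(1) show False by auto
    qed
  qed
  moreover have "C = range (curve \<epsilon> s)"
    if per: "periodic_orbit (regularized_focus \<phi> \<epsilon>) C" and CU: "C \<subseteq> U" for C
  proof -
    from per obtain \<gamma> T where \<gamma>: "integral_curve_on (regularized_focus \<phi> \<epsilon>) UNIV \<gamma>" "T > 0"
      "\<And>t. \<gamma> (t + T) = \<gamma> t" "C = range \<gamma>"
      unfolding periodic_orbit_def by blast
    have "(0, 0) \<notin> U" using \<epsilon> by (simp add: U_def)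
    moreover have "\<gamma> 0 \<in> U" using CU \<gamma>(4) by blast
    ultimately have "\<gamma> 0 \<noteq> 0" by (metis zero_prod_def)
    from integral_curve_eq_curve[OF \<epsilon> \<gamma>(1) this] obtain a b where ab: "\<And>t. \<gamma> t = curve \<epsilon> a (t + b)" by blast
    have per: "curve \<epsilon> a (t + T) = curve \<epsilon> a t" for t
      using \<gamma>(3)[of "t - b"] ab[of "t - b"] ab[of "t - b + T"] by (simp add: algebra_simps)
    have "curve \<epsilon> a t \<in> C" for t using ab[of "t - b"] \<gamma>(4) by (metis diff_add_cancel rangeI)
    then have C: "C = range (curve \<epsilon> a)" using \<gamma>(4) ab by auto
    have "\<bar>a - s\<bar> < \<eta>"
    proof (rule ccontr)
      assume "\<not> \<bar>a - s\<bar> < \<eta>"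
      then have "a \<le> s - \<eta> \<or> s + \<eta> \<le> a" by linarith
      then have "\<epsilon> * exp a \<le> \<epsilon> * exp (s - \<eta>) \<or> \<epsilon> * exp (s + \<eta>) \<le> \<epsilon> * exp a" using \<epsilon> by auto
      moreover have "0 \<le> \<epsilon> * exp a" using \<epsilon> by simp
      ultimately have "curve \<epsilon> a 0 \<notin> U" by (auto simp: curve_0 U_def)
      then show False using C CU by blast
    qed
    moreover have "return_log a = a"
    proof -
      have T: "curve \<epsilon> a T = (\<epsilon> * exp a, 0)" using per[of 0] by (simp add: curve_0)
      moreover have "0 \<le> \<epsilon> * exp a" using \<epsilon> by simp
      ultimately obtain n :: int where n: "T = of_int n * (2 * pi)"
        by (rule curve_on_positive_axis[OF \<epsilon>])
      with \<gamma>(2) have "n > 0" by (simp add: zero_less_mult_iff)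
      then obtain m where m: "n = int m" "m > 0" by (metis pos_int_cases)
      have "cos T = 1" unfolding n by (metis cos_one_2pi_int mult.assoc mult.commute)
      then have "flow a T = a" using T \<epsilon> by (simp add: curve_def)
      then have "(return_log ^^ m) a = a"
        using flow_periods[of a m] n m by (simp add: mult.commute)
      then show ?thesis using fixed_point_of_iterate m(2) by blast
    qed
    ultimately show ?thesis using \<eta>(2) C by metis
  qed
  ultimately show ?thesis
    unfolding limit_cycle_def using periodic_orbit_curve[OF \<epsilon> s(1)] by blast
qed

text \<open>The section is the segment of the \<open>x\<close>-axis from \<open>0\<close> to \<open>2 \<epsilon> e\<^sup>s\<close>, with coordinate \<open>u\<close> such that
\<open>x = \<epsilon> (e\<^sup>s + u)\<close>. There the return map is conjugate to \<open>return_log\<close> by the logarithm, and a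
conjugation does not change the derivative at a fixed point.\<close>

lemma hyperbolic_limit_cycle_curve:
  assumes \<epsilon>: "\<epsilon> > 0" and s: "return_log s = s" "exponent s \<noteq> 0"
  shows "hyperbolic_limit_cycle (regularized_focus \<phi> \<epsilon>) (range (curve \<epsilon> s))"
proof -
  define R where "R = exp s"
  define P where "P u = exp (return_log (ln (R + u))) - R" for u
  define p v :: "real \<times> real" where "p = (\<epsilon> * R, 0)" and "v = (\<epsilon>, 0)"
  have R: "R > 0" by (simp add: R_def)
  have P0: "P 0 = 0" using s(1) by (simp add: P_def R_def)
  have segment: "section_segment p v R = {\<epsilon> * (R + u) |u. -R < u \<and> u < R} \<times> {0}"
    by (auto simp: section_segment_def p_def v_def algebra_simps)
  have DP: "(P has_real_derivative exp (exponent s)) (at 0)"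
  proof -
    have "(ln has_real_derivative 1 / R) (at (R + 0))" using DERIV_ln_divide[OF R] by simp
    moreover have "((\<lambda>u. R + u) has_real_derivative 0 + 1) (at 0)"
      by (rule DERIV_add[OF DERIV_const DERIV_ident])
    ultimately have 1: "((\<lambda>u. ln (R + u)) has_real_derivative 1 / R * (0 + 1)) (at 0)"
      by (rule DERIV_chain2)
    have "ln (R + 0) = s" by (simp add: R_def)
    then have 2: "(return_log has_real_derivative exp (exponent s)) (at (ln (R + 0)))"
      using return_log_derivative by simp
    have "(P has_real_derivative
        exp (return_log (ln (R + 0))) * (exp (exponent s) * (1 / R * (0 + 1))) - 0) (at 0)"
      unfolding P_def[abs_def]
      by (rule DERIV_diff[OF DERIV_chain2[OF DERIV_exp DERIV_chain2[OF 2 1]] DERIV_const])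
    then show ?thesis using s(1) by (simp add: R_def)
  qed
  have "transversal_section (regularized_focus \<phi> \<epsilon>) p v R"
    unfolding transversal_section_def segment using R \<epsilon>
    by (auto simp: v_def zero_prod_def span_singleton regularized_focus_eq)
  moreover have "\<forall>\<^sub>F u in nhds 0. u \<in> {-R<..<R} \<and>
      first_return (regularized_focus \<phi> \<epsilon>) (section_segment p v R) (p + u *\<^sub>R v) (p + P u *\<^sub>R v)"
  proof -
    have "(P \<longlongrightarrow> P 0) (nhds 0)"
      using DERIV_isCont[OF DP] by (simp add: isCont_def tendsto_at_iff_tendsto_nhds)
    then have "\<forall>\<^sub>F u in nhds 0. P u < R" using R P0 by (intro order_tendstoD) auto
    moreover have "\<forall>\<^sub>F u in nhds 0. u \<in> {-R<..<R}"
      by (rule eventually_nhds_in_open) (use R in auto)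
    ultimately show ?thesis
    proof eventually_elim
      case (elim u)
      then have u: "R + u > 0" "exp (ln (R + u)) = R + u" by auto
      let ?a = "ln (R + u)"
      have Pu: "- R < P u" by (simp add: P_def)
      have "curve \<epsilon> ?a 0 = p + u *\<^sub>R v"
        unfolding curve_0 u(2) by (simp add: p_def v_def algebra_simps)
      moreover have "curve \<epsilon> ?a (2 * pi) = p + P u *\<^sub>R v"
        by (simp add: curve_def p_def v_def P_def return_log_def algebra_simps)
      moreover have "p + P u *\<^sub>R v \<in> section_segment p v R"
        using Pu elim(1) by (auto simp: section_segment_def)
      moreover have "curve \<epsilon> ?a t \<notin> section_segment p v R" if t: "t \<in> {0<..<2 * pi}" for t
      proof
        assume "curve \<epsilon> ?a t \<in> section_segment p v R"
        then obtain w where w: "- R < w" "curve \<epsilon> ?a t = (\<epsilon> * (R + w), 0)"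
          unfolding segment by auto
        then have "\<epsilon> * (R + w) \<ge> 0" using \<epsilon> by simp
        from curve_on_positive_axis[OF \<epsilon> w(2) this] obtain n :: int where "t = of_int n * (2 * pi)" .
        with t have "0 < of_int n * (2 * pi)" "of_int n * (2 * pi) < 1 * (2 * pi)" by auto
        then have "0 < n" "(of_int n :: real) < 1"
          by (simp_all add: zero_less_mult_iff)
        then show False by simp
      qed
      ultimately show ?case
        unfolding first_return_def using elim(2) integral_curve_curve[OF \<epsilon>]
        by (intro conjI exI[of _ "curve \<epsilon> ?a"] exI[of _ "2 * pi"]) auto
    qed
  qed
  ultimately have "poincare_return_map (regularized_focus \<phi> \<epsilon>) p v R P"
    by (simp add: poincare_return_map_def)
  moreover have "p \<in> range (curve \<epsilon> s)"
    by (metis R_def curve_0 p_def rangeI)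
  moreover have "exp (exponent s) \<noteq> 1" using s(2) by simp
  ultimately show ?thesis
    unfolding hyperbolic_limit_cycle_def using limit_cycle_curve[OF \<epsilon> s] P0 DP by blast
qed

end

section \<open>Averaging\<close>

text \<open>Up to the factor \<open>2\<pi>\<close> the mean of \<open>h\<close> along the circle of logarithmic radius \<open>s\<close>.\<close>

definition average :: "(real \<Rightarrow> real) \<Rightarrow> real \<Rightarrow> real" where
  "average h s = integral {0..2 * pi} (\<lambda>t. h (exp s * cos t))"

context polar_profile
begin

text \<open>During one turn \<open>\<rho>\<close> grows by at most \<open>2\<pi> < 8\<close>, because \<open>|\<phi>| \<le> 1\<close>. An orbit that starts at
\<open>s \<le> -9\<close> therefore stays in the strip where \<open>\<phi>\<close> has its prescribed form, without any bootstrap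
argument.\<close>

lemma flow_stays_inside:
  assumes "s \<le> -9" "0 \<le> t" "t \<le> 2 * pi"
  shows "flow s t \<le> 0" "\<bar>exp (flow s t) * cos t\<bar> \<le> 1 / 2"
proof -
  have "\<bar>flow s t - flow s 0\<bar> \<le> \<bar>t - 0\<bar>" by (rule flow_lipschitz_time)
  then have 1: "flow s t \<le> -1" using assms flow_0[of s] pi_less_4 by linarith
  then show "flow s t \<le> 0" by simp
  have "exp (flow s t) \<le> exp (-1)" using 1 by simp
  also have "exp (-1) \<le> (1 / 2 :: real)"
    using exp_ge_add_one_self[of 1] by (simp add: exp_minus field_simps)
  finally have "exp (flow s t) * \<bar>cos t\<bar> \<le> 1 / 2 * 1"
    by (intro mult_mono) auto
  then show "\<bar>exp (flow s t) * cos t\<bar> \<le> 1 / 2" by (simp add: abs_mult)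
qed

text \<open>Inside the strip the speed \<open>|\<rho>'|\<close> is at most \<open>\<delta> C\<close>, so the orbit stays within \<open>2\<pi> \<delta> C\<close> of the circle
on which it starts; the Lipschitz constant of \<open>G\<close> and the length of the turn do the rest.\<close>

lemma average_along_flow:
  assumes G: "continuous_on UNIV G"
    and lip: "\<And>x y. \<bar>x\<bar> \<le> 1 / 2 \<Longrightarrow> \<bar>y\<bar> \<le> 1 / 2 \<Longrightarrow> \<bar>G x - G y\<bar> \<le> C * \<bar>x - y\<bar>"
    and small: "\<And>x. \<bar>x\<bar> \<le> 1 / 2 \<Longrightarrow> \<bar>\<phi> x\<bar> \<le> \<delta> * C"
    and "C \<ge> 0" "\<delta> \<ge> 0" and s: "s \<le> -9"
  shows "\<bar>integral {0..2 * pi} (\<lambda>t. G (exp (flow s t) * cos t)) - average G s\<bar> \<le> \<delta> * (2 * pi * C)\<^sup>2"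
proof -
  have c1: "continuous_on {0..2 * pi} (\<lambda>t. G (exp (flow s t) * cos t))"
    by (rule continuous_on_compose2[OF G]) (auto intro!: continuous_intros flow_continuous)
  have c2: "continuous_on {0..2 * pi} (\<lambda>t. G (exp s * cos t))"
    by (rule continuous_on_compose2[OF G]) (auto intro!: continuous_intros)
  have "integral {0..2 * pi} (\<lambda>t. G (exp (flow s t) * cos t)) - average G s
      = integral {0..2 * pi} (\<lambda>t. G (exp (flow s t) * cos t) - G (exp s * cos t))"
    unfolding average_def
    by (rule Henstock_Kurzweil_Integration.integral_diff[symmetric])
       (intro integrable_continuous_real c1 c2)+
  also have "norm \<dots> \<le> C * (\<delta> * C * (2 * pi)) * (2 * pi - 0)"
  proof (rule integral_bound)
    show "continuous_on {0..2 * pi} (\<lambda>t. G (exp (flow s t) * cos t) - G (exp s * cos t))"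
      by (intro continuous_on_diff c1 c2)
    fix t assume t: "t \<in> {0..2 * pi}"
    note inside = flow_stays_inside[OF s]
    have "exp s \<le> exp (-1)" using s by simp
    also have "exp (-1) \<le> (1 / 2 :: real)"
      using exp_ge_add_one_self[of 1] by (simp add: exp_minus field_simps)
    finally have "exp s * \<bar>cos t\<bar> \<le> 1 / 2 * 1" by (intro mult_mono) auto
    then have 0: "\<bar>exp s * cos t\<bar> \<le> 1 / 2" by (simp add: abs_mult)
    have 1: "\<bar>flow s t - s\<bar> \<le> \<delta> * C * (2 * pi)"
    proof (cases "t = 0")
      case True
      then show ?thesis using assms by simp
    next
      case False
      with t obtain z where z: "0 < z" "z < t" "flow s t - flow s 0 = (t - 0) * \<phi> (exp (flow s z) * cos z)"
        using MVT2[of 0 t "flow s" "\<lambda>z. \<phi> (exp (flow s z) * cos z)"] flow_derivative by auto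
      have "\<bar>\<phi> (exp (flow s z) * cos z)\<bar> \<le> \<delta> * C"
        using z t by (intro small inside) auto
      then have "t * \<bar>\<phi> (exp (flow s z) * cos z)\<bar> \<le> (2 * pi) * (\<delta> * C)"
        using t by (intro mult_mono) auto
      then show ?thesis using z(3) t by (simp add: abs_mult mult_ac)
    qed
    have 2: "\<bar>exp (flow s t) - exp s\<bar> \<le> \<bar>flow s t - s\<bar>"
    proof -
      obtain z where z: "z \<le> max (flow s t) s" "divided_difference exp exp (flow s t) s = exp z"
        using divided_difference_mean_value[of exp exp "flow s t" s, OF DERIV_exp] by blast
      have "max (flow s t) s \<le> 0" using inside(1)[of t] t s by auto
      with z(1) have "\<bar>exp z\<bar> \<le> 1" by auto
      then show ?thesis
        using divided_difference_times[of exp exp "flow s t" s] z(2)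
          mult_right_mono[of "\<bar>exp z\<bar>" 1 "\<bar>flow s t - s\<bar>"] by (metis abs_ge_zero abs_mult mult_1)
    qed
    have "\<bar>G (exp (flow s t) * cos t) - G (exp s * cos t)\<bar> \<le> C * \<bar>exp (flow s t) * cos t - exp s * cos t\<bar>"
      using t by (intro lip inside 0) auto
    also have "\<bar>exp (flow s t) * cos t - exp s * cos t\<bar> = \<bar>exp (flow s t) - exp s\<bar> * \<bar>cos t\<bar>"
      by (simp add: abs_mult[symmetric] left_diff_distrib)
    also have "C * \<dots> \<le> C * (\<bar>exp (flow s t) - exp s\<bar> * 1)"
      using assms by (intro mult_left_mono) auto
    also have "\<dots> \<le> C * (\<delta> * C * (2 * pi))"
      using 1 2 assms by (intro mult_left_mono) auto
    finally show "norm (G (exp (flow s t) * cos t) - G (exp s * cos t)) \<le> C * (\<delta> * C * (2 * pi))"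
      by simp
  qed simp
  also have "\<dots> = \<delta> * (2 * pi * C)\<^sup>2" by (simp add: power2_eq_square algebra_simps)
  finally show ?thesis by simp
qed

lemma return_log_integral:
  "return_log s - s = integral {0..2 * pi} (\<lambda>t. \<phi> (exp (flow s t) * cos t))"
proof -
  have "((\<lambda>t. \<phi> (exp (flow s t) * cos t)) has_integral flow s (2 * pi) - flow s 0) {0..2 * pi}"
    by (rule fundamental_theorem_of_calculus)
       (auto simp: has_real_derivative_iff_has_vector_derivative[symmetric]
         intro: has_field_derivative_at_within flow_derivative)
  then show ?thesis by (simp add: return_log_def integral_unique)
qed

text \<open>With \<open>k(x) = x h'(x)\<close> the displacement of the return map and the exponent are \<open>\<delta>\<close> times averages of
\<open>h\<close> and \<open>k\<close> along the orbit. They have the signs of the averages over circles as soon as the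
error of \<open>average_along_flow\<close> is below the margin \<open>\<kappa>\<close>.\<close>

lemma return_log_zero_from_average:
  assumes h: "continuous_on UNIV h" "\<And>x. \<bar>x\<bar> \<le> 1 / 2 \<Longrightarrow> \<phi> x = \<delta> * h x"
      "\<And>x y. \<bar>x\<bar> \<le> 1 / 2 \<Longrightarrow> \<bar>y\<bar> \<le> 1 / 2 \<Longrightarrow> \<bar>h x - h y\<bar> \<le> C * \<bar>x - y\<bar>"
      "\<And>x. \<bar>x\<bar> \<le> 1 / 2 \<Longrightarrow> \<bar>h x\<bar> \<le> C"
    and k: "continuous_on UNIV k" "\<And>x. \<bar>x\<bar> \<le> 1 / 2 \<Longrightarrow> x * \<phi>' x = \<delta> * k x"
      "\<And>x y. \<bar>x\<bar> \<le> 1 / 2 \<Longrightarrow> \<bar>y\<bar> \<le> 1 / 2 \<Longrightarrow> \<bar>k x - k y\<bar> \<le> C * \<bar>x - y\<bar>"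
    and \<delta>: "\<delta> > 0" "\<delta> * (2 * pi * C)\<^sup>2 < \<kappa>"
    and ab: "a \<le> b" "b \<le> -9" "average h a * average h b < 0"
      "\<kappa> \<le> \<bar>average h a\<bar>" "\<kappa> \<le> \<bar>average h b\<bar>"
      "\<And>s. a \<le> s \<Longrightarrow> s \<le> b \<Longrightarrow> \<kappa> \<le> \<bar>average k s\<bar>"
  shows "\<exists>s. a \<le> s \<and> s \<le> b \<and> return_log s = s \<and> exponent s \<noteq> 0"
proof -
  have C: "C \<ge> 0" using h(4)[of 0] by linarith
  have small: "\<bar>\<phi> x\<bar> \<le> \<delta> * C" if "\<bar>x\<bar> \<le> 1 / 2" for x
    using h(2)[OF that] h(4)[OF that] \<delta>(1) by (simp add: abs_mult)
  define H where "H s = integral {0..2 * pi} (\<lambda>t. h (exp (flow s t) * cos t))" for s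
  have H: "\<bar>H s - average h s\<bar> < \<kappa>" "return_log s - s = \<delta> * H s" if "s \<le> -9" for s
  proof -
    have "\<bar>H s - average h s\<bar> \<le> \<delta> * (2 * pi * C)\<^sup>2"
      unfolding H_def by (rule average_along_flow[OF h(1,3) small C _ that]) (use \<delta> in auto)
    then show "\<bar>H s - average h s\<bar> < \<kappa>" using \<delta> by linarith
    have "return_log s - s = integral {0..2 * pi} (\<lambda>t. \<delta> * h (exp (flow s t) * cos t))"
      unfolding return_log_integral
      by (rule integral_cong) (use flow_stays_inside[OF that] in \<open>simp add: h(2)\<close>)
    then show "return_log s - s = \<delta> * H s" by (simp add: H_def)
  qed
  have rc: "continuous_on {a..b} (\<lambda>s. return_log s - s)"
  proof (rule continuous_on_diff[OF continuous_at_imp_continuous_on continuous_on_id], rule ballI)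
    show "isCont return_log s" for s using return_log_derivative by (rule DERIV_isCont)
  qed
  have "\<exists>s\<ge>a. s \<le> b \<and> return_log s - s = 0"
  proof (cases "average h a < 0")
    case True
    with ab(3) have "average h b > 0" by (simp add: mult_less_0_iff)
    then have "H a < 0" "H b > 0" using True H(1)[of a] H(1)[of b] ab by linarith+
    then have "return_log a - a \<le> 0" "0 \<le> return_log b - b"
      using H(2) ab \<delta>(1) by (simp_all add: mult_le_0_iff)
    from IVT'[of "\<lambda>s. return_log s - s", OF this ab(1) rc] show ?thesis by blast
  next
    case False
    with ab(3) have "average h b < 0" "average h a > 0" by (simp_all add: mult_less_0_iff)
    then have "H b < 0" "H a > 0" using H(1)[of a] H(1)[of b] ab by linarith+
    then have "return_log b - b \<le> 0" "0 \<le> return_log a - a"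
      using H(2) ab \<delta>(1) by (simp_all add: mult_le_0_iff)
    from IVT2'[of "\<lambda>s. return_log s - s", OF this ab(1) rc] show ?thesis by blast
  qed
  then obtain s where s: "a \<le> s" "s \<le> b" "return_log s = s" by auto
  then have s8: "s \<le> -9" using ab by simp
  define K where "K = integral {0..2 * pi} (\<lambda>t. k (exp (flow s t) * cos t))"
  have "\<bar>K - average k s\<bar> \<le> \<delta> * (2 * pi * C)\<^sup>2"
    unfolding K_def by (rule average_along_flow[OF k(1,3) small C _ s8]) (use \<delta> in auto)
  then have "K \<noteq> 0" using \<delta> ab(6)[OF s(1,2)] by linarith
  moreover have "exponent s = \<delta> * K"
  proof -
    have "exponent s = integral {0..2 * pi} (\<lambda>t. \<delta> * k (exp (flow s t) * cos t))"
      unfolding exponent_def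
      by (rule integral_cong) (use flow_stays_inside[OF s8] in \<open>simp add: k(2)\<close>)
    then show ?thesis by (simp add: K_def)
  qed
  ultimately show ?thesis using s \<delta> by auto
qed

end

text \<open>A simple zero produces a sign change with a margin \<open>\<kappa>\<close>, and on the bracketing interval the
derivative stays away from zero by the same margin. These are exactly the data that survive a
small perturbation.\<close>

lemma simple_zero_bracket:
  fixes J J' :: "real \<Rightarrow> real"
  assumes J: "\<And>s. (J has_real_derivative J' s) (at s)" and J': "continuous_on UNIV J'"
    and c: "J c = 0" "J' c \<noteq> 0" and \<eta>: "\<eta> > 0"
  shows "\<exists>a b \<kappa>. c - \<eta> < a \<and> a \<le> b \<and> b < c + \<eta> \<and> \<kappa> > 0 \<and> J a * J b < 0
    \<and> \<kappa> \<le> \<bar>J a\<bar> \<and> \<kappa> \<le> \<bar>J b\<bar> \<and> (\<forall>s. a \<le> s \<and> s \<le> b \<longrightarrow> \<kappa> \<le> \<bar>J' s\<bar>)"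
proof -
  define m where "m = \<bar>J' c\<bar> / 2"
  have m: "m > 0" using c by (simp add: m_def)
  obtain d where d: "d > 0" "\<And>s. dist s c < d \<Longrightarrow> dist (J' s) (J' c) < m"
    using J' m by (metis UNIV_I continuous_on_iff)
  define r where "r = min d \<eta> / 2"
  have r: "r > 0" "r < d" "r < \<eta>" using d(1) \<eta> by (auto simp: r_def)
  have near: "m \<le> \<bar>J' s\<bar> \<and> J' s * J' c > 0" if "\<bar>s - c\<bar> \<le> r" for s
  proof -
    have "\<bar>J' s - J' c\<bar> < m" using d(2)[of s] that r by (simp add: dist_real_def)
    then show ?thesis using c(2) by (auto simp: m_def zero_less_mult_iff abs_if split: if_splits)
  qed
  obtain y where y: "c < y" "y < c + r" "J (c + r) - J c = (c + r - c) * J' y"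
    using MVT2[of c "c + r" J J'] J r by auto
  obtain z where z: "c - r < z" "z < c" "J c - J (c - r) = (c - (c - r)) * J' z"
    using MVT2[of "c - r" c J J'] J r by auto
  have ny: "m \<le> \<bar>J' y\<bar>" "J' y * J' c > 0" and nz: "m \<le> \<bar>J' z\<bar>" "J' z * J' c > 0"
    using near[of y] near[of z] y z by auto
  have J2: "J (c + r) = r * J' y" "J (c - r) = - (r * J' z)" using y(3) z(3) c(1) by auto
  define \<kappa> where "\<kappa> = min m (r * m)"
  show ?thesis
  proof (intro exI conjI allI impI)
    show "c - \<eta> < c - r" "c - r \<le> c + r" "c + r < c + \<eta>" using r by auto
    show "\<kappa> > 0" using m r by (simp add: \<kappa>_def)
    have "J' y * J' z > 0" using ny(2) nz(2) by (auto simp: zero_less_mult_iff)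
    then show "J (c - r) * J (c + r) < 0"
      unfolding J2 using r by (auto simp: mult_less_0_iff zero_less_mult_iff)
    show "\<kappa> \<le> \<bar>J (c - r)\<bar>" "\<kappa> \<le> \<bar>J (c + r)\<bar>"
      unfolding J2 \<kappa>_def using ny(1) nz(1) r
      by (auto simp: abs_mult intro!: min.coboundedI2 mult_left_mono)
    show "\<kappa> \<le> \<bar>J' s\<bar>" if "c - r \<le> s \<and> s \<le> c + r" for s
      using near[of s] that unfolding \<kappa>_def by (intro min.coboundedI1) (auto simp: abs_le_iff)
  qed
qed

section \<open>Polynomials with prescribed averages\<close>

text \<open>The linear term does not contribute to the average and will make the polynomial increasing; the even
terms carry the average.\<close>

definition profile :: "real \<Rightarrow> (nat \<Rightarrow> real) \<Rightarrow> nat \<Rightarrow> real \<Rightarrow> real" where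
  "profile \<alpha> \<beta> n x = \<alpha> * x + (\<Sum>j\<le>n. \<beta> j * x ^ (2 * j))"

definition profile' :: "real \<Rightarrow> (nat \<Rightarrow> real) \<Rightarrow> nat \<Rightarrow> real \<Rightarrow> real" where
  "profile' \<alpha> \<beta> n x = \<alpha> + (\<Sum>j\<le>n. real (2 * j) * \<beta> j * x ^ (2 * j - 1))"

lemma profile_has_derivative: "(profile \<alpha> \<beta> n has_real_derivative profile' \<alpha> \<beta> n x) (at x)"
proof -
  have "((\<lambda>x. \<Sum>j\<le>n. \<beta> j * x ^ (2 * j)) has_real_derivative
      (\<Sum>j\<le>n. \<beta> j * (real (2 * j) * x ^ (2 * j - Suc 0)))) (at x)"
    by (rule DERIV_sum[OF DERIV_cmult[OF DERIV_pow]])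
  from DERIV_add[OF DERIV_cmult[OF DERIV_ident, of \<alpha> x UNIV] this]
  show ?thesis by (simp add: profile_def[abs_def] profile'_def mult_ac)
qed

text \<open>The function \<open>x h'(x)\<close>, whose average is the exponent, is a profile again.\<close>

lemma times_profile': "x * profile' \<alpha> \<beta> n x = profile \<alpha> (\<lambda>j. real (2 * j) * \<beta> j) n x"
proof -
  have "x * (real (2 * j) * \<beta> j * x ^ (2 * j - 1)) = real (2 * j) * \<beta> j * x ^ (2 * j)" for j
    by (cases j) (simp_all add: mult_ac)
  then show ?thesis
    unfolding profile'_def profile_def distrib_left sum_distrib_left by (simp only: mult.commute[of x \<alpha>])
qed

lemma Ck_real_profile: "Ck_real k (profile \<alpha> \<beta> n)"
  unfolding profile_def[abs_def]
  by (intro Ck_real_add Ck_real_mult Ck_real_sum Ck_real_power Ck_real_const Ck_real_ident)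

lemma power_sum_bound:
  assumes "\<bar>x\<bar> \<le> (1::real)"
  shows "\<bar>\<Sum>j\<le>n. b j * x ^ e j\<bar> \<le> (\<Sum>j\<le>n. \<bar>b j\<bar>)"
proof (rule order_trans[OF sum_abs sum_mono])
  fix j
  have "\<bar>x\<bar> ^ e j \<le> 1" using assms by (intro power_le_one) auto
  then show "\<bar>b j * x ^ e j\<bar> \<le> \<bar>b j\<bar>"
    using mult_left_mono[of "\<bar>x\<bar> ^ e j" 1 "\<bar>b j\<bar>"] by (simp add: abs_mult power_abs)
qed

lemma profile_bound:
  assumes "\<bar>x\<bar> \<le> 1" shows "\<bar>profile \<alpha> \<beta> n x\<bar> \<le> \<bar>\<alpha>\<bar> + (\<Sum>j\<le>n. \<bar>\<beta> j\<bar>)"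
proof -
  have "\<bar>\<alpha> * x\<bar> \<le> \<bar>\<alpha>\<bar>" using mult_left_mono[OF assms, of "\<bar>\<alpha>\<bar>"] by (simp add: abs_mult)
  then show ?thesis using power_sum_bound[OF assms, of \<beta> "\<lambda>j. 2 * j" n]
    unfolding profile_def by linarith
qed

lemma profile'_bound:
  assumes "\<bar>x\<bar> \<le> 1"
  shows "\<bar>profile' \<alpha> \<beta> n x - \<alpha>\<bar> \<le> (\<Sum>j\<le>n. \<bar>real (2 * j) * \<beta> j\<bar>)"
  using power_sum_bound[OF assms, of "\<lambda>j. real (2 * j) * \<beta> j" "\<lambda>j. 2 * j - 1" n]
  unfolding profile'_def by simp

lemma profile_lipschitz:
  assumes "\<bar>x\<bar> \<le> 1" "\<bar>y\<bar> \<le> 1"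
  shows "\<bar>profile \<alpha> \<beta> n x - profile \<alpha> \<beta> n y\<bar> \<le> (\<bar>\<alpha>\<bar> + (\<Sum>j\<le>n. \<bar>real (2 * j) * \<beta> j\<bar>)) * \<bar>x - y\<bar>"
proof -
  obtain z where z: "min x y \<le> z" "z \<le> max x y"
    "divided_difference (profile \<alpha> \<beta> n) (profile' \<alpha> \<beta> n) x y = profile' \<alpha> \<beta> n z"
    using divided_difference_mean_value[of "profile \<alpha> \<beta> n" "profile' \<alpha> \<beta> n" x y, OF profile_has_derivative]
    by blast
  then have "\<bar>z\<bar> \<le> 1" using assms by (auto simp: abs_le_iff min_def max_def split: if_splits)
  from profile'_bound[OF this, of \<alpha> \<beta> n]
  have "\<bar>profile' \<alpha> \<beta> n z\<bar> \<le> \<bar>\<alpha>\<bar> + (\<Sum>j\<le>n. \<bar>real (2 * j) * \<beta> j\<bar>)" by linarith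
  then show ?thesis
    using divided_difference_times[of "profile \<alpha> \<beta> n" "profile' \<alpha> \<beta> n" x y, symmetric] z(3)
    by (simp add: abs_mult mult_right_mono)
qed

text \<open>The factor by which averaging multiplies the even monomial of degree \<open>2 j\<close>.\<close>

definition cos_moment :: "nat \<Rightarrow> real" where
  "cos_moment j = integral {0..2 * pi} (\<lambda>t. cos t ^ (2 * j))"

lemma cos_moment_has_integral: "((\<lambda>t. cos t ^ (2 * j)) has_integral cos_moment j) {0..2 * pi}"
  unfolding cos_moment_def
  by (intro integrable_integral integrable_continuous_real continuous_intros)

text \<open>The integrand is nonnegative and continuous, with value \<open>1\<close> at \<open>0\<close>.\<close>

lemma cos_moment_nonzero: "cos_moment j \<noteq> 0"
proof
  assume "cos_moment j = 0"
  then have "((\<lambda>t. cos t ^ (2 * j)) has_integral 0) (cbox 0 (2 * pi))"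
    using cos_moment_has_integral[of j] by simp
  then have "cos 0 ^ (2 * j) = (0 :: real)"
    by (intro has_integral_0_cbox_imp_0[of 0 "2 * pi" "\<lambda>t. cos t ^ (2 * j)"])
       (auto intro!: continuous_intros simp: pi_gt_zero not_le)
  then show False by simp
qed

lemma average_profile:
  "average (profile \<alpha> \<beta> n) s = (\<Sum>j\<le>n. \<beta> j * cos_moment j * exp (real (2 * j) * s))"
proof -
  have "(cos has_integral sin (2 * pi) - sin 0) {0..2 * pi}"
    by (rule fundamental_theorem_of_calculus)
       (auto simp: has_real_derivative_iff_has_vector_derivative[symmetric]
         intro: has_field_derivative_at_within DERIV_sin)
  then have "((\<lambda>t. \<alpha> * exp s * cos t) has_integral \<alpha> * exp s * 0) {0..2 * pi}"
    by (intro has_integral_mult_right) simp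
  moreover have "((\<lambda>t. \<Sum>j\<le>n. (\<beta> j * exp (real (2 * j) * s)) * cos t ^ (2 * j)) has_integral
      (\<Sum>j\<le>n. (\<beta> j * exp (real (2 * j) * s)) * cos_moment j)) {0..2 * pi}"
    by (rule has_integral_sum[OF finite_atMost has_integral_mult_right[OF cos_moment_has_integral]])
  ultimately have "((\<lambda>t. \<alpha> * exp s * cos t + (\<Sum>j\<le>n. (\<beta> j * exp (real (2 * j) * s)) * cos t ^ (2 * j)))
      has_integral \<alpha> * exp s * 0 + (\<Sum>j\<le>n. (\<beta> j * exp (real (2 * j) * s)) * cos_moment j)) {0..2 * pi}"
    by (rule has_integral_add)
  moreover have "\<alpha> * exp s * cos t + (\<Sum>j\<le>n. (\<beta> j * exp (real (2 * j) * s)) * cos t ^ (2 * j))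
      = profile \<alpha> \<beta> n (exp s * cos t)" for t
    by (simp add: profile_def power_mult_distrib exp_of_nat_mult[symmetric] mult.assoc)
  ultimately show ?thesis
    unfolding average_def by (simp add: integral_unique mult_ac)
qed

lemma average_profile_has_derivative:
  "(average (profile \<alpha> \<beta> n) has_real_derivative average (profile \<alpha> (\<lambda>j. real (2 * j) * \<beta> j) n) s) (at s)"
proof -
  have "((\<lambda>s. \<Sum>j\<le>n. \<beta> j * cos_moment j * exp (real (2 * j) * s)) has_real_derivative
      (\<Sum>j\<le>n. \<beta> j * cos_moment j * (exp (real (2 * j) * s) * (real (2 * j) * 1)))) (at s)"
    by (rule DERIV_sum[OF DERIV_cmult[OF DERIV_chain2[OF DERIV_exp DERIV_cmult[OF DERIV_ident]]]])
  then show ?thesis by (simp add: average_profile[abs_def] mult_ac)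
qed

lemma continuous_on_average_profile: "continuous_on A (average (profile \<alpha> \<beta> n))"
proof (rule continuous_at_imp_continuous_on, rule ballI)
  show "isCont (average (profile \<alpha> \<beta> n)) s" for s
    using average_profile_has_derivative by (rule DERIV_isCont)
qed

section \<open>Transition functions with prescribed inner part\<close>

text \<open>The function \<open>f\<close> is faded out by the first step on the right, on \<open>[1/2, 5/8]\<close>, and by a step on the
left, on \<open>[-1, -1/2]\<close>. Meanwhile the values \<open>1/4\<close> and \<open>-1\<close> are faded in. Three further steps of
height \<open>1/4\<close> and width \<open>1/8\<close> lead from \<open>1/4\<close> to \<open>1\<close>. At each of the junctions \<open>5/8\<close>, \<open>3/4\<close>, \<open>7/8\<close> all
derivatives vanish.\<close>

definition glue :: "(real \<Rightarrow> real) \<Rightarrow> real \<Rightarrow> real" where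
  "glue f t = f t * (1 - smooth_step (8 * t + - 4) - smooth_step (- 2 * t + - 1))
    + (smooth_step (8 * t + - 4) + smooth_step (8 * t + - 5)
       + smooth_step (8 * t + - 6) + smooth_step (8 * t + - 7)) * (1 / 4)
    - smooth_step (- 2 * t + - 1)"

text \<open>The derivative of \<open>glue f\<close>, arranged so that for small increasing \<open>f\<close> every summand is nonnegative
on \<open>[-1, 1]\<close>.\<close>

definition glue' :: "(real \<Rightarrow> real) \<Rightarrow> (real \<Rightarrow> real) \<Rightarrow> real \<Rightarrow> real" where
  "glue' f f' t = f' t * (1 - smooth_step (8 * t + - 4) - smooth_step (- 2 * t + - 1))
    + 8 * smooth_step' (8 * t + - 4) * (1 / 4 - f t)
    + 2 * smooth_step' (- 2 * t + - 1) * (1 + f t)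
    + 2 * (smooth_step' (8 * t + - 5) + smooth_step' (8 * t + - 6) + smooth_step' (8 * t + - 7))"

lemma Ck_real_glue: "Ck_real k f \<Longrightarrow> Ck_real k (glue f)"
  unfolding glue_def[abs_def]
  by (intro Ck_real_add Ck_real_diff Ck_real_mult Ck_real_const Ck_real_affine[OF Ck_real_smooth_step])

lemma glue_has_derivative:
  assumes "(f has_real_derivative f' t) (at t)"
  shows "(glue f has_real_derivative glue' f f' t) (at t)"
proof -
  have S: "((\<lambda>t. smooth_step (a * t + b)) has_real_derivative smooth_step' (a * t + b) * a) (at t)" for a b
    by (rule DERIV_chain2[OF smooth_step_has_derivative]) (auto intro!: derivative_eq_intros)
  show ?thesis unfolding glue_def[abs_def]
    by (rule DERIV_cong, (rule DERIV_diff DERIV_add DERIV_mult assms S DERIV_const)+)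
       (simp add: glue'_def algebra_simps)
qed

lemma glue_inner: "\<bar>t\<bar> \<le> 1 / 2 \<Longrightarrow> glue f t = f t"
  by (simp add: glue_def smooth_step_eq_0)

lemma glue'_inner: "\<bar>t\<bar> \<le> 1 / 2 \<Longrightarrow> glue' f f' t = f' t"
  by (simp add: glue'_def smooth_step_eq_0 smooth_step'_eq_0_left abs_le_iff)

lemma glue_left: "t \<le> -1 \<Longrightarrow> glue f t = -1"
  by (simp add: glue_def smooth_step_eq_0 smooth_step_eq_1)

lemma glue_right: "t \<ge> 1 \<Longrightarrow> glue f t = 1"
  by (simp add: glue_def smooth_step_eq_0 smooth_step_eq_1)

lemma glue'_outer: "\<bar>t\<bar> \<ge> 1 \<Longrightarrow> glue' f f' t = 0"
  by (auto simp: glue'_def smooth_step_eq_0 smooth_step_eq_1 smooth_step'_eq_0_left smooth_step'_eq_0_right abs_if split: if_splits)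

lemma Ck_real_derivative:
  assumes "Ck_real (Suc k) f" "\<And>x. (f has_real_derivative f' x) (at x)"
  shows "Ck_real k f'"
proof -
  obtain g where g: "\<And>x. (f has_real_derivative g x) (at x)" "Ck_real k g" using assms(1) by auto
  have "f' = g" using DERIV_unique[OF assms(2) g(1)] by blast
  then show ?thesis using g(2) by simp
qed

locale inner_part =
  fixes f f' :: "real \<Rightarrow> real"
  assumes f_derivative: "\<And>x. (f has_real_derivative f' x) (at x)"
    and f_smooth: "\<And>k. Ck_real k f"
    and f_small: "\<And>x. \<bar>x\<bar> \<le> 1 \<Longrightarrow> \<bar>f x\<bar> < 1 / 4"
    and f'_pos: "\<And>x. \<bar>x\<bar> \<le> 1 \<Longrightarrow> f' x > 0"
begin

lemma glue_derivative: "(glue f has_real_derivative glue' f f' t) (at t)"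
  by (rule glue_has_derivative[where f' = f', OF f_derivative])

lemma glue'_terms_nonneg:
  assumes "\<bar>t\<bar> \<le> 1"
  shows "f' t * (1 - smooth_step (8 * t + - 4) - smooth_step (- 2 * t + - 1)) \<ge> 0"
    "8 * smooth_step' (8 * t + - 4) * (1 / 4 - f t) \<ge> 0"
    "2 * smooth_step' (- 2 * t + - 1) * (1 + f t) \<ge> 0"
proof -
  have "1 - smooth_step (8 * t + - 4) - smooth_step (- 2 * t + - 1) \<ge> 0"
    using smooth_step_le_1[of "8 * t + - 4"] smooth_step_le_1[of "- 2 * t + - 1"]
    by (cases "t \<ge> 0") (simp_all add: smooth_step_eq_0)
  then show "f' t * (1 - smooth_step (8 * t + - 4) - smooth_step (- 2 * t + - 1)) \<ge> 0"
    using f'_pos[OF assms] by (intro mult_nonneg_nonneg) auto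
  show "8 * smooth_step' (8 * t + - 4) * (1 / 4 - f t) \<ge> 0"
    using f_small[OF assms] smooth_step'_ge_0 by (intro mult_nonneg_nonneg) (auto simp: abs_less_iff)
  show "2 * smooth_step' (- 2 * t + - 1) * (1 + f t) \<ge> 0"
    using f_small[OF assms] smooth_step'_ge_0 by (intro mult_nonneg_nonneg) (auto simp: abs_less_iff)
qed

lemma glue'_nonneg:
  assumes "\<bar>t\<bar> \<le> 1" shows "glue' f f' t \<ge> 0"
  unfolding glue'_def
  by (intro add_nonneg_nonneg glue'_terms_nonneg[OF assms] mult_nonneg_nonneg[of 2] smooth_step'_ge_0) simp

lemma glue_bounded: "\<bar>glue f t\<bar> \<le> 1"
proof -
  consider "t \<le> -1" | "t \<ge> 1" | "-1 \<le> t" "t \<le> 1" by linarith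
  then show ?thesis
  proof cases
    case 3
    have mono: "glue f a \<le> glue f b" if ab: "-1 \<le> a" "a \<le> b" "b \<le> 1" for a b
    proof (rule DERIV_nonneg_imp_nondecreasing[OF ab(2)], rule exI, rule conjI, rule glue_derivative)
      show "0 \<le> glue' f f' x" if "a \<le> x" "x \<le> b" for x
        using that ab by (intro glue'_nonneg) auto
    qed
    show ?thesis using mono[of "-1" t] mono[of t 1] 3 by (simp add: glue_left glue_right)
  qed (simp_all add: glue_left glue_right)
qed

text \<open>If a sum of nonnegative terms vanishes, then every term does. The vanishing of the step derivatives
confines \<open>t\<close> to the inner interval, where \<open>f' > 0\<close>, or to the junctions.\<close>

lemma glue'_eq_0_iff:
  assumes t: "-1 < t" "t < 1"
  shows "glue' f f' t = 0 \<longleftrightarrow> t \<in> {5 / 8, 3 / 4, 7 / 8}"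
proof
  assume "t \<in> {5 / 8, 3 / 4, 7 / 8}"
  then show "glue' f f' t = 0"
    by (auto simp: glue'_def smooth_step_eq_0 smooth_step_eq_1 smooth_step'_eq_0_left smooth_step'_eq_0_right)
next
  assume zero: "glue' f f' t = 0"
  have t1: "\<bar>t\<bar> \<le> 1" using t by auto
  note terms = glue'_terms_nonneg[OF t1]
  have steps: "smooth_step' x \<ge> 0" for x by (rule smooth_step'_ge_0)
  have sum_zero: "B = 0 \<and> D = 0 \<and> E = 0 \<and> F = 0 \<and> G = 0"
    if "A + B + D + 2 * (E + F + G) = 0" "0 \<le> A" "0 \<le> B" "0 \<le> D" "0 \<le> E" "0 \<le> F" "0 \<le> G"
    for A B D E F G :: real
    using that by (smt (verit))
  have z: "8 * smooth_step' (8 * t + - 4) * (1 / 4 - f t) = 0"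
    "2 * smooth_step' (- 2 * t + - 1) * (1 + f t) = 0"
    "smooth_step' (8 * t + - 5) = 0" "smooth_step' (8 * t + - 6) = 0" "smooth_step' (8 * t + - 7) = 0"
    using sum_zero[OF zero[unfolded glue'_def] terms steps steps steps] by blast+
  have no_step: "x \<le> 0 \<or> 1 \<le> x" if "smooth_step' x = 0" for x
    using smooth_step'_pos[of x] that by linarith
  have "smooth_step' (8 * t + - 4) = 0" "smooth_step' (- 2 * t + - 1) = 0"
    using z(1,2) f_small[OF t1] by (auto simp: abs_less_iff)
  note ranges = no_step[OF this(1)] no_step[OF this(2)] no_step[OF z(3)] no_step[OF z(4)] no_step[OF z(5)]
  have "\<not> (-1 / 2 \<le> t \<and> t \<le> 1 / 2)"
  proof
    assume "-1 / 2 \<le> t \<and> t \<le> 1 / 2"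
    then have "\<bar>t\<bar> \<le> 1 / 2" by auto
    from glue'_inner[OF this, of f f'] zero f'_pos[OF t1] show False by simp
  qed
  with ranges t show "t \<in> {5 / 8, 3 / 4, 7 / 8}" by auto
qed

lemma deriv_glue: "deriv (glue f) t = glue' f f' t"
  by (rule DERIV_imp_deriv[OF glue_derivative])

lemma critical_points_glue: "critical_points (glue f) \<inter> {-1<..<1} = {5 / 8, 3 / 4, 7 / 8}"
  using glue'_eq_0_iff by (auto simp: critical_points_def deriv_glue)

lemma smooth_on_glue:
  assumes "bounded_linear L" shows "smooth_on S (\<lambda>x. glue f (L x))"
  by (rule smooth_on_of_Ck_real[OF Ck_real_glue[OF f_smooth] assms])

lemma transition_function_glue: "transition_function (glue f)"
  unfolding transition_function_def
  using smooth_on_glue[OF bounded_linear_ident] by (simp add: glue_left glue_right)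

lemma non_monotonic_glue: "non_monotonic_transition_function (glue f)"
proof -
  have "deriv (glue f) (3 / 4) = 0" using glue'_eq_0_iff[of "3 / 4"] by (simp add: deriv_glue)
  then have "\<not> monotonic_transition_function (glue f)"
    unfolding monotonic_transition_function_def by (auto intro!: bexI[of _ "3 / 4"])
  then show ?thesis by (simp add: non_monotonic_transition_function_def transition_function_glue)
qed

lemma smooth_transition_family_glue: "smooth_transition_family B (\<lambda>b. glue f)"
  unfolding smooth_transition_family_def
  unfolding case_prod_beta
  using smooth_on_glue[OF bounded_linear_fst] transition_function_glue by blast

lemma polar_profile_glue: "\<exists>L. polar_profile (glue f) (glue' f f') L"
proof -
  have c: "continuous_on UNIV (glue' f f')"
    using Ck_real_derivative[OF Ck_real_glue[OF f_smooth[of "Suc 0"]] glue_derivative]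
    by simp
  then have "continuous_on {-1..1} (\<lambda>x. x * glue' f f' x)"
    by (intro continuous_on_mult continuous_on_id) (rule continuous_on_subset, auto)
  then have "bounded ((\<lambda>x. x * glue' f f' x) ` {-1..1})"
    by (intro compact_imp_bounded compact_continuous_image compact_Icc)
  then obtain L where L: "L > 0" "\<And>x. x \<in> {-1..1} \<Longrightarrow> \<bar>x * glue' f f' x\<bar> \<le> L"
    unfolding bounded_pos by auto
  have "\<bar>x * glue' f f' x\<bar> \<le> L" for x
  proof (cases "\<bar>x\<bar> \<ge> 1")
    case True
    then show ?thesis using L(1) by (simp add: glue'_outer)
  next
    case False
    then show ?thesis by (intro L(2)) auto
  qed
  then have "polar_profile (glue f) (glue' f f') L"
    by unfold_locales (rule glue_derivative c glue_bounded | assumption)+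
  then show ?thesis ..
qed

end

section \<open>Many limit cycles\<close>

text \<open>After division by the moments the coefficients of \<open>\<Prod>\<^sub>c (z - e\<^sup>2\<^sup>c)\<close> become the even coefficients
of the profile, whose average at \<open>s\<close> is then the value of this polynomial at \<open>z = e\<^sup>2\<^sup>s\<close>.\<close>

lemma profile_with_simple_zeros:
  fixes A :: "real set"
  assumes "finite A"
  shows "\<exists>\<beta> n. \<forall>\<alpha>. \<forall>c\<in>A. average (profile \<alpha> \<beta> n) c = 0 \<and>
    average (profile \<alpha> (\<lambda>j. real (2 * j) * \<beta> j) n) c \<noteq> 0"
proof -
  define Q where "Q = (\<Prod>c\<in>A. [:- exp (2 * c), 1:])"
  define \<beta> where "\<beta> j = coeff Q j / cos_moment j" for j
  define n where "n = degree Q"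
  have avg: "average (profile \<alpha> \<beta> n) s = poly Q (exp (2 * s))" for \<alpha> s
    unfolding average_profile poly_altdef n_def
    by (intro sum.cong) (simp_all add: \<beta>_def cos_moment_nonzero exp_of_nat_mult[symmetric] mult_ac)
  have avg': "average (profile \<alpha> (\<lambda>j. real (2 * j) * \<beta> j) n) s
      = poly (pderiv Q) (exp (2 * s)) * (exp (2 * s) * (2 * 1))" for \<alpha> s
  proof (rule DERIV_unique[OF average_profile_has_derivative])
    have "((\<lambda>s. poly Q (exp (2 * s))) has_real_derivative
        poly (pderiv Q) (exp (2 * s)) * (exp (2 * s) * (2 * 1))) (at s)"
      by (rule DERIV_chain2[OF poly_DERIV DERIV_chain2[OF DERIV_exp DERIV_cmult[OF DERIV_ident]]])
    then show "(average (profile \<alpha> \<beta> n) has_real_derivative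
        poly (pderiv Q) (exp (2 * s)) * (exp (2 * s) * (2 * 1))) (at s)"
      by (simp add: avg[abs_def])
  qed
  have "poly Q (exp (2 * c)) = 0 \<and> poly (pderiv Q) (exp (2 * c)) \<noteq> 0" if c: "c \<in> A" for c
  proof -
    define R where "R = (\<Prod>d\<in>A - {c}. [:- exp (2 * d), 1:])"
    have Q: "Q = [:- exp (2 * c), 1:] * R"
      unfolding Q_def R_def by (rule prod.remove[OF assms c])
    have "poly R (exp (2 * c)) = (\<Prod>d\<in>A - {c}. exp (2 * c) - exp (2 * d))"
      by (simp add: R_def poly_prod)
    also have "\<dots> \<noteq> 0" using assms by (auto simp: prod_zero_iff)
    finally have "poly R (exp (2 * c)) \<noteq> 0" .
    moreover have "pderiv Q = [:- exp (2 * c), 1:] * pderiv R + R * pderiv [:- exp (2 * c), 1:]"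
      unfolding Q by (rule pderiv_mult)
    ultimately show ?thesis by (simp add: Q pderiv_pCons del: mult_pCons_left)
  qed
  then show ?thesis
    by (intro exI[of _ \<beta>] exI[of _ n], unfold avg avg') simp
qed

text \<open>Since \<open>A\<close> is finite, one \<open>\<delta>\<close> is small enough for the brackets of all zeros at once, and also for
\<open>|\<delta> h| < 1/4\<close>, which the gluing needs. The bound \<open>-10\<close> leaves room for a bracket of radius \<open>1/2\<close>
below \<open>-9\<close>.\<close>

lemma inner_part_with_closed_orbits:
  assumes A: "finite A" "\<And>c. c \<in> A \<Longrightarrow> c \<le> -10"
  shows "\<exists>f f' \<sigma>. inner_part f f' \<and> (\<forall>c\<in>A. \<bar>\<sigma> c - c\<bar> < 1 / 2 \<and>
    polar_profile.return_log (glue f) (\<sigma> c) = \<sigma> c \<and>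
    polar_profile.exponent (glue f) (glue' f f') (\<sigma> c) \<noteq> 0)"
proof -
  obtain \<beta> n where \<beta>: "\<And>\<alpha> c. c \<in> A \<Longrightarrow> average (profile \<alpha> \<beta> n) c = 0"
    "\<And>\<alpha> c. c \<in> A \<Longrightarrow> average (profile \<alpha> (\<lambda>j. real (2 * j) * \<beta> j) n) c \<noteq> 0"
    using profile_with_simple_zeros[OF A(1)] by blast
  define \<beta>' where "\<beta>' j = real (2 * j) * \<beta> j" for j
  \<comment> \<open>the linear coefficient exceeds any derivative of the even part on \<open>[-1, 1]\<close>\<close>
  define \<alpha> where "\<alpha> = 1 + (\<Sum>j\<le>n. \<bar>\<beta>' j\<bar>)"
  define h k where "h = profile \<alpha> \<beta> n" and "k = profile \<alpha> \<beta>' n"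
  define h' where "h' = profile' \<alpha> \<beta> n"
  have h'_deriv: "(h has_real_derivative h' x) (at x)" and k_eq: "x * h' x = k x" for x
    unfolding h_def h'_def k_def \<beta>'_def by (rule profile_has_derivative times_profile')+
  have h'_pos: "h' x > 0" if "\<bar>x\<bar> \<le> 1" for x
    using profile'_bound[OF that, of \<alpha> \<beta> n] unfolding h'_def \<alpha>_def \<beta>'_def by linarith
  have "\<exists>a b \<kappa>. c - 1/2 < a \<and> a \<le> b \<and> b < c + 1/2 \<and> \<kappa> > 0 \<and> average h a * average h b < 0
      \<and> \<kappa> \<le> \<bar>average h a\<bar> \<and> \<kappa> \<le> \<bar>average h b\<bar> \<and> (\<forall>s. a \<le> s \<and> s \<le> b \<longrightarrow> \<kappa> \<le> \<bar>average k s\<bar>)"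
    if c: "c \<in> A" for c
  proof (rule simple_zero_bracket)
    show "(average h has_real_derivative average k s) (at s)" for s
      unfolding h_def k_def \<beta>'_def by (rule average_profile_has_derivative)
    show "continuous_on UNIV (average k)" unfolding k_def by (rule continuous_on_average_profile)
    show "average h c = 0" "average k c \<noteq> 0"
      using \<beta>[OF c] unfolding h_def k_def \<beta>'_def by auto
  qed simp
  then obtain a b \<kappa> where bracket: "\<And>c. c \<in> A \<Longrightarrow> c - 1/2 < a c \<and> a c \<le> b c \<and> b c < c + 1/2 \<and>
      \<kappa> c > 0 \<and> average h (a c) * average h (b c) < 0 \<and> \<kappa> c \<le> \<bar>average h (a c)\<bar> \<and>
      \<kappa> c \<le> \<bar>average h (b c)\<bar> \<and> (\<forall>s. a c \<le> s \<and> s \<le> b c \<longrightarrow> \<kappa> c \<le> \<bar>average k s\<bar>)"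
    by metis
  define C where "C = \<bar>\<alpha>\<bar> + (\<Sum>j\<le>n. \<bar>\<beta> j\<bar>) + (\<Sum>j\<le>n. \<bar>\<beta>' j\<bar>) + (\<Sum>j\<le>n. \<bar>real (2 * j) * \<beta>' j\<bar>)"
  have sums: "0 \<le> (\<Sum>j\<le>n. \<bar>\<beta> j\<bar>)" "0 \<le> (\<Sum>j\<le>n. \<bar>\<beta>' j\<bar>)" "0 \<le> (\<Sum>j\<le>n. \<bar>real (2 * j) * \<beta>' j\<bar>)"
    by (intro sum_nonneg abs_ge_zero)+
  have C: "C \<ge> 0" using sums unfolding C_def by linarith
  have h_bound: "\<bar>h x\<bar> \<le> C" if "\<bar>x\<bar> \<le> 1" for x
    using profile_bound[OF that, of \<alpha> \<beta> n] sums unfolding h_def C_def by linarith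
  have lip: "\<bar>h x - h y\<bar> \<le> C * \<bar>x - y\<bar>" "\<bar>k x - k y\<bar> \<le> C * \<bar>x - y\<bar>" if "\<bar>x\<bar> \<le> 1" "\<bar>y\<bar> \<le> 1" for x y
  proof -
    have "\<bar>\<alpha>\<bar> + (\<Sum>j\<le>n. \<bar>real (2 * j) * \<beta> j\<bar>) \<le> C" "\<bar>\<alpha>\<bar> + (\<Sum>j\<le>n. \<bar>real (2 * j) * \<beta>' j\<bar>) \<le> C"
      using sums unfolding C_def \<beta>'_def by linarith+
    then show "\<bar>h x - h y\<bar> \<le> C * \<bar>x - y\<bar>" "\<bar>k x - k y\<bar> \<le> C * \<bar>x - y\<bar>"
      using profile_lipschitz[OF that, of \<alpha> _ n] unfolding h_def k_def
      by (meson abs_ge_zero mult_right_mono order_trans)+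
  qed
  \<comment> \<open>the element \<open>1\<close> keeps the minimum meaningful for empty \<open>A\<close>\<close>
  define \<kappa>0 where "\<kappa>0 = Min (insert 1 (\<kappa> ` A))"
  have \<kappa>0: "\<kappa>0 > 0" "\<And>c. c \<in> A \<Longrightarrow> \<kappa>0 \<le> \<kappa> c"
    using A(1) bracket by (auto simp: \<kappa>0_def)
  define D where "D = (2 * pi * C)\<^sup>2"
  have D: "D \<ge> 0" by (simp add: D_def)
  define \<delta> where "\<delta> = min (\<kappa>0 / (2 * (D + 1))) (1 / (8 * (C + 1)))"
  have \<delta>: "\<delta> > 0" using \<kappa>0(1) C D by (simp add: \<delta>_def)
  have \<delta>D: "\<delta> * D < \<kappa>0"
  proof -
    have "\<delta> * D \<le> \<kappa>0 / (2 * (D + 1)) * D"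
      using D by (intro mult_right_mono) (auto simp: \<delta>_def)
    also have "\<dots> < \<kappa>0" using \<kappa>0(1) D by (simp add: field_simps add_nonneg_pos)
    finally show ?thesis .
  qed
  have \<delta>C: "\<delta> * C < 1 / 4"
  proof -
    have "\<delta> * C \<le> 1 / (8 * (C + 1)) * C"
      using C by (intro mult_right_mono) (auto simp: \<delta>_def)
    also have "\<dots> < 1 / 4" using C by (simp add: field_simps)
    finally show ?thesis .
  qed
  define f f' where "f x = \<delta> * h x" and "f' x = \<delta> * h' x" for x
  have inner: "inner_part f f'"
  proof
    show "(f has_real_derivative f' x) (at x)" for x
      unfolding f_def[abs_def] f'_def by (rule DERIV_cmult[OF h'_deriv])
    show "Ck_real k f" for k
      unfolding f_def[abs_def] h_def by (intro Ck_real_mult Ck_real_const Ck_real_profile)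
    show "\<bar>f x\<bar> < 1 / 4" if "\<bar>x\<bar> \<le> 1" for x
    proof -
      have "\<bar>f x\<bar> = \<delta> * \<bar>h x\<bar>" using \<delta> by (simp add: f_def abs_mult)
      also have "\<dots> \<le> \<delta> * C" using h_bound[OF that] \<delta> by (intro mult_left_mono) auto
      finally show ?thesis using \<delta>C by linarith
    qed
    show "f' x > 0" if "\<bar>x\<bar> \<le> 1" for x
      using h'_pos[OF that] \<delta> by (simp add: f'_def)
  qed
  then obtain L where "polar_profile (glue f) (glue' f f') L"
    using inner_part.polar_profile_glue by blast
  then interpret polar_profile "glue f" "glue' f f'" L .
  have "\<exists>s. a c \<le> s \<and> s \<le> b c \<and> return_log s = s \<and> exponent s \<noteq> 0" if c: "c \<in> A" for c
  proof (rule return_log_zero_from_average[of h \<delta> C k "\<kappa> c"])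
    show "continuous_on UNIV h" "continuous_on UNIV k"
      unfolding h_def k_def by (rule Ck_real_imp_continuous[OF Ck_real_profile])+
    show "glue f x = \<delta> * h x" if "\<bar>x\<bar> \<le> 1 / 2" for x
      using that by (simp add: glue_inner f_def)
    show "x * glue' f f' x = \<delta> * k x" if "\<bar>x\<bar> \<le> 1 / 2" for x
      using that by (simp add: glue'_inner f'_def k_eq[symmetric])
    show "\<delta> * (2 * pi * C)\<^sup>2 < \<kappa> c" using \<delta>D \<kappa>0(2)[OF c] unfolding D_def by linarith
    show "b c \<le> -9" using bracket[OF c] A(2)[OF c] by linarith
  qed (use lip h_bound \<delta> bracket[OF c] in auto)
  then obtain \<sigma> where \<sigma>: "\<And>c. c \<in> A \<Longrightarrow> a c \<le> \<sigma> c \<and> \<sigma> c \<le> b c \<and> return_log (\<sigma> c) = \<sigma> c \<and> exponent (\<sigma> c) \<noteq> 0"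
    by metis
  have "\<bar>\<sigma> c - c\<bar> < 1 / 2" if "c \<in> A" for c
  proof -
    have "c - 1/2 < a c" "b c < c + 1/2" "a c \<le> \<sigma> c" "\<sigma> c \<le> b c"
      using \<sigma>[OF that] bracket[OF that] by auto
    then show ?thesis by linarith
  qed
  with \<sigma> inner show ?thesis by blast
qed

text \<open>The zeros of the average are put at the logarithmic radii \<open>-10, -11, \<dots>, -10 - k\<close>. The cycle that
belongs to each of them starts less than \<open>1/2\<close> away from it, so the \<open>k + 1\<close> cycles cross the positive
axis at distinct points.\<close>

theorem theorem2:
  "\<exists>X Y :: planar_vf. affine_vf X \<and> affine_vf Y \<and>
    (\<forall>k::nat. k > 0 \<longrightarrow>
      (\<exists>(B::real set) (\<phi> :: real \<Rightarrow> real \<Rightarrow> real) (\<epsilon>\<^sub>k::real) (b\<^sub>k :: real \<Rightarrow> real).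
        open B \<and> 0 \<in> B \<and>
        smooth_transition_family B \<phi> \<and>
        (\<forall>b\<in>B. non_monotonic_transition_function (\<phi> b) \<and>
               card (critical_points (\<phi> b) \<inter> {-1<..<1}) = 3) \<and>
        \<epsilon>\<^sub>k > 0 \<and> continuous_on {0..\<epsilon>\<^sub>k} b\<^sub>k \<and> b\<^sub>k ` {0..\<epsilon>\<^sub>k} \<subseteq> B \<and> b\<^sub>k 0 = 0 \<and>
        (\<forall>\<epsilon>\<in>{0<..\<epsilon>\<^sub>k}. \<exists>S. card S = k + 1 \<and>
           (\<forall>C\<in>S. hyperbolic_limit_cycle (linear_regularization (\<phi> (b\<^sub>k \<epsilon>)) X Y \<epsilon>) C))))"
proof (rule exI[of _ repelling_focus], rule exI[of _ attracting_focus],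
    intro conjI allI impI affine_repelling_focus affine_attracting_focus)
  fix k :: nat
  define A where "A = (\<lambda>i. -10 - real i) ` {..k}"
  have A: "finite A" "card A = k + 1" "\<And>c. c \<in> A \<Longrightarrow> c \<le> -10"
    by (auto simp: A_def card_image inj_on_def)
  obtain f f' \<sigma> where inner: "inner_part f f'"
    and \<sigma>: "\<And>c. c \<in> A \<Longrightarrow> \<bar>\<sigma> c - c\<bar> < 1 / 2"
      "\<And>c. c \<in> A \<Longrightarrow> polar_profile.return_log (glue f) (\<sigma> c) = \<sigma> c"
      "\<And>c. c \<in> A \<Longrightarrow> polar_profile.exponent (glue f) (glue' f f') (\<sigma> c) \<noteq> 0"
    using inner_part_with_closed_orbits[OF A(1,3)] by blast
  interpret inner_part f f' by (rule inner)
  obtain L where "polar_profile (glue f) (glue' f f') L" using polar_profile_glue by blast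
  then interpret polar_profile "glue f" "glue' f f'" L .
  have inj_\<sigma>: "inj_on \<sigma> A"
  proof (rule inj_onI)
    fix c d assume cd: "c \<in> A" "d \<in> A" "\<sigma> c = \<sigma> d"
    then obtain i j where ij: "c = -10 - real i" "d = -10 - real j" by (auto simp: A_def)
    have "\<bar>c - d\<bar> < 1" using \<sigma>(1)[OF cd(1)] \<sigma>(1)[OF cd(2)] cd(3) by linarith
    then have "\<bar>int i - int j\<bar> < 1" unfolding ij by linarith
    then show "c = d" by (simp add: ij)
  qed
  have cycles: "\<exists>S. card S = k + 1 \<and> (\<forall>C\<in>S. hyperbolic_limit_cycle (regularized_focus (glue f) \<epsilon>) C)"
    if \<epsilon>: "\<epsilon> > 0" for \<epsilon>
  proof (intro exI conjI ballI)
    let ?S = "(\<lambda>c. range (curve \<epsilon> (\<sigma> c))) ` A"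
    have "inj_on (\<lambda>c. range (curve \<epsilon> (\<sigma> c))) A"
    proof (rule inj_onI)
      fix c d assume cd: "c \<in> A" "d \<in> A" "range (curve \<epsilon> (\<sigma> c)) = range (curve \<epsilon> (\<sigma> d))"
      then have "(\<epsilon> * exp (\<sigma> c), 0) \<in> range (curve \<epsilon> (\<sigma> d))" by (metis curve_0 rangeI)
      from closed_curve_on_positive_axis[OF \<epsilon> \<sigma>(2)[OF cd(2)] this] \<epsilon> have "\<sigma> c = \<sigma> d" by simp
      then show "c = d" using inj_\<sigma> cd by (simp add: inj_on_eq_iff)
    qed
    then show "card ?S = k + 1" using A(2) by (simp add: card_image)
    show "hyperbolic_limit_cycle (regularized_focus (glue f) \<epsilon>) C" if "C \<in> ?S" for C
      using that hyperbolic_limit_cycle_curve[OF \<epsilon> \<sigma>(2,3)] by blast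
  qed
  show "\<exists>(B::real set) (\<phi> :: real \<Rightarrow> real \<Rightarrow> real) (\<epsilon>\<^sub>k::real) (b\<^sub>k :: real \<Rightarrow> real).
        open B \<and> 0 \<in> B \<and>
        smooth_transition_family B \<phi> \<and>
        (\<forall>b\<in>B. non_monotonic_transition_function (\<phi> b) \<and>
               card (critical_points (\<phi> b) \<inter> {-1<..<1}) = 3) \<and>
        \<epsilon>\<^sub>k > 0 \<and> continuous_on {0..\<epsilon>\<^sub>k} b\<^sub>k \<and> b\<^sub>k ` {0..\<epsilon>\<^sub>k} \<subseteq> B \<and> b\<^sub>k 0 = 0 \<and>
        (\<forall>\<epsilon>\<in>{0<..\<epsilon>\<^sub>k}. \<exists>S. card S = k + 1 \<and>
           (\<forall>C\<in>S. hyperbolic_limit_cycle (regularized_focus (\<phi> (b\<^sub>k \<epsilon>)) \<epsilon>) C))"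
    using cycles smooth_transition_family_glue non_monotonic_glue
    by (intro exI[of _ UNIV] exI[of _ "\<lambda>_. glue f"] exI[of _ 1] exI[of _ "\<lambda>_. 0"])
       (simp add: critical_points_glue)
qed

end
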